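(* Let $(Z(t),X(t))$ be the Feller Markov process on $\mathbb T\times\{0,1\}^{\mathbb Z^d}$ generated by the closed operator $\mathbf R$ described in the context (a simple exclusion model with creation and annihilation of particles, interacting with a moving heavy particle). Then the measure $\kappa$ on $\mathbb T\times\{0,1\}^{\mathbb Z^d}$ given by $$\kappa(z,\mathbb A)=\frac{1}{\sigma(z)}\int_{\mathbb A}e^{\varphi\,\mathrm x_z}\,d\gamma(x),\qquad z\in\mathbb T,\ \mathbb A\subseteq\{0,1\}^{\mathbb Z^d},$$ is a finite invariant measure for the process $(Z(t),X(t))$.
   Context: Parameters: $\varphi\in\mathbb R$, $\lambda,\mu>0$; $\beta_{ii'}=\beta_{i'i}\ge0$ for $i,i'\in\mathbb Z^d$ with $\beta_{ii}=0$ and $\sup_{i}\sum_{i'}\beta_{ii'}<\infty$; $\mathbb T\subset\mathbb Z^d$ a finite set; $\tau_{zz'}=\tau_{z'z}\ge0$ for $z,z'\in\mathbb T$ with $\tau_{zz}=0$; time-scaling coefficients $\alpha(z)>0$, $\sigma(z)>0$ for $z\in\mathbb T$. Configurations are $x=(\mathrm x_i)_{i\in\mathbb Z^d}\in\{0,1\}^{\mathbb Z^d}$ (product topology); $e^i$ is the configuration with value $1$ at $i$ and $0$ elsewhere; $e^{i\to i'}=e^{i'}-e^i$; configurations are added and subtracted as functions. $\gamma$ is the product measure on $\{0,1\}^{\mathbb Z^d}$ under which the $\mathrm x_i$ are independent with $P(\mathrm x_i=1)=\lambda/(\lambda+\mu)$, $P(\mathrm x_i=0)=\mu/(\lambda+\mu)$.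 For a function $\phi$ on $\mathbb T\times\{0,1\}^{\mathbb Z^d}$ put $$\mathbf R\phi(z,x)=\alpha(z)\,\mathbf L^{(z)}\phi(z,x)+\frac{\sigma(z)}{e^{\varphi\mathrm x_z}}\,\mathbf A\phi(z,x),\qquad \mathbf A\phi(z,x)=\sum_{z'\in\mathbb T}\tau_{zz'}[\phi(z',x)-\phi(z,x)],$$ $$\begin{aligned}\mathbf L^{(z)}\phi(z,x)=&\sum_{i,i'\in\mathbb Z^d:\ i\ne i'\ne z}\mathrm x_i(1-\mathrm x_{i'})\beta_{ii'}[\phi(z,x+e^{i\to i'})-\phi(z,x)]\\&+\sum_{i\ne z}\Big\{\mathrm x_i(1-\mathrm x_z)\beta_{iz}e^{\varphi}[\phi(z,x+e^{i\to z})-\phi(z,x)]\\&\qquad+\lambda(1-\mathrm x_i)[\phi(z,x+e^i)-\phi(z,x)]+\mu\,\mathrm x_i[\phi(z,x-e^i)-\phi(z,x)]\Big\}\\&+\lambda e^{\varphi}(1-\mathrm x_z)[\phi(z,x+e^z)-\phi(z,x)]+\mu\,\mathrm x_z[\phi(z,x-e^z)-\phi(z,x)],\end{aligned}$$ where $i\ne i'\ne z$ means $i\neq i'$ and $i'\neq z$. Let $\mathrm C_{\mathrm L}(\{0,1\}^{\mathbb Z^d})$ be the space of continuous functions $g$ on $\{0,1\}^{\mathbb Z^d}$ of Lipschitz type, i.e. with $$|||g|||:=\sup_{x\in\{0,1\}^{\mathbb Z^d}}\Big[\sum_{i}\mathrm x_i|g(x-e^i)-g(x)|+\sum_{i}(1-\mathrm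 x_i)|g(x+e^i)-g(x)|+\sum_{i,i'}\mathrm x_i(1-\mathrm x_{i'})|g(x+e^{i\to i'})-g(x)|\Big]<\infty,$$ the sums being over $\mathbb Z^d$. Let $\mathrm C_{\mathrm L}(\mathbb T\times\{0,1\}^{\mathbb Z^d})$ be the space of continuous $\phi$ on $\mathbb T\times\{0,1\}^{\mathbb Z^d}$ such that for every $z\in\mathbb T$ the section $x\mapsto\phi(z,x)$ lies in $\mathrm C_{\mathrm L}(\{0,1\}^{\mathbb Z^d})$. The operator $\mathbf R$ is considered initially on $\mathrm C_{\mathrm L}(\mathbb T\times\{0,1\}^{\mathbb Z^d})$, and then its closure in the space $\mathrm C(\mathbb T\times\{0,1\}^{\mathbb Z^d})$ of continuous functions is taken, still denoted $\mathbf R$; thus $\mathrm C_{\mathrm L}(\mathbb T\times\{0,1\}^{\mathbb Z^d})$ is a core for $\mathbf R$. By Liggett's theory of interacting particle systems, as invoked by the authors, there exists a unique Feller semigroup on $\mathrm C(\mathbb T\times\{0,1\}^{\mathbb Z^d})$ generated by $\mathbf R$; $(Z(t),X(t))$ is the corresponding Markov process, with right-continuous trajectories having left limits.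
   Formalization: As printed, the seminorm |||g||| is infinite for every nonconstant continuous g, so R on C_L generates no Feller process; the formal theorem also allows the pair sum over i,i' to carry the weights β_{ii'} (the printed weight 1 is kept as the other case), and R starts on those φ in C_L with Rφ continuous. *)

theory Defs
  imports "HOL-Probability.Probability"
begin

subsection \<open>Feller semigroups, their generators and processes\<close>

text \<open>
  All notions are relative to a compact set \<open>S\<close>.  An element of \<open>C(S)\<close> is represented by a function
  on the whole type that is continuous on \<open>S\<close>; its values outside \<open>S\<close> are irrelevant.  Operators
  on \<open>C(S)\<close> are represented by their graphs.
\<close>

definition feller_semigroup ::
  "'s::topological_space set \<Rightarrow> (real \<Rightarrow> ('s \<Rightarrow> real) \<Rightarrow> 's \<Rightarrow> real) \<Rightarrow> bool" where
  "feller_semigroup S P \<longleftrightarrow>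
     (\<forall>t\<ge>0. \<forall>f. continuous_on S f \<longrightarrow> continuous_on S (P t f)) \<and>
     (\<forall>t\<ge>0. \<forall>f g a b. continuous_on S f \<longrightarrow> continuous_on S g \<longrightarrow>
        (\<forall>\<xi>\<in>S. P t (\<lambda>\<eta>. a * f \<eta> + b * g \<eta>) \<xi> = a * P t f \<xi> + b * P t g \<xi>)) \<and>
     (\<forall>f. continuous_on S f \<longrightarrow> (\<forall>\<xi>\<in>S. P 0 f \<xi> = f \<xi>)) \<and>
     (\<forall>s\<ge>0. \<forall>t\<ge>0. \<forall>f. continuous_on S f \<longrightarrow> (\<forall>\<xi>\<in>S. P (s + t) f \<xi> = P s (P t f) \<xi>)) \<and>
     (\<forall>t\<ge>0. \<forall>\<xi>\<in>S. P t (\<lambda>_. 1) \<xi> = 1) \<and>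
     (\<forall>t\<ge>0. \<forall>f. continuous_on S f \<longrightarrow> (\<forall>\<xi>\<in>S. 0 \<le> f \<xi>) \<longrightarrow> (\<forall>\<xi>\<in>S. 0 \<le> P t f \<xi>)) \<and>
     (\<forall>t\<ge>0. \<forall>f. continuous_on S f \<longrightarrow> uniform_limit S (\<lambda>s. P s f) (P t f) (at_right t))"

definition generator ::
  "'s::topological_space set \<Rightarrow> (real \<Rightarrow> ('s \<Rightarrow> real) \<Rightarrow> 's \<Rightarrow> real) \<Rightarrow> (('s \<Rightarrow> real) \<times> ('s \<Rightarrow> real)) set"
  where
  "generator S P = {(f, h). continuous_on S f \<and> continuous_on S h \<and>
     uniform_limit S (\<lambda>t \<xi>. (P t f \<xi> - f \<xi>) / t) h (at_right 0)}"

definition graph_closure ::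
  "'s::topological_space set \<Rightarrow> (('s \<Rightarrow> real) \<times> ('s \<Rightarrow> real)) set \<Rightarrow> (('s \<Rightarrow> real) \<times> ('s \<Rightarrow> real)) set"
  where
  "graph_closure S G = {(f, h). continuous_on S f \<and> continuous_on S h \<and>
     (\<exists>F H. (\<forall>n::nat. (F n, H n) \<in> G) \<and>
        uniform_limit S F f sequentially \<and> uniform_limit S H h sequentially)}"

definition past ::
  "'w set \<Rightarrow> 's measure \<Rightarrow> (real \<Rightarrow> 'w \<Rightarrow> 's) \<Rightarrow> real \<Rightarrow> 'w measure" where
  "past \<Omega> E Y s = sigma \<Omega> {Y u -` B \<inter> \<Omega> | u B. 0 \<le> u \<and> u \<le> s \<and> B \<in> sets E}"

text \<open>
  \<open>Pr \<xi>\<close> is the law of the process started at \<open>\<xi>\<close>; \<open>\<Omega>\<close> is the measurable space on which all these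
  laws live, and \<open>E\<close> is the state space with its \<open>\<sigma>\<close>-algebra.
\<close>

definition feller_process ::
  "(real \<Rightarrow> ('s::topological_space \<Rightarrow> real) \<Rightarrow> 's \<Rightarrow> real) \<Rightarrow>
   's measure \<Rightarrow> 'w measure \<Rightarrow> ('s \<Rightarrow> 'w measure) \<Rightarrow> (real \<Rightarrow> 'w \<Rightarrow> 's) \<Rightarrow> bool" where
  "feller_process P E \<Omega> Pr Y \<longleftrightarrow>
     (\<forall>t\<ge>0. Y t \<in> measurable \<Omega> E) \<and>
     (\<forall>\<omega>\<in>space \<Omega>. \<forall>t\<ge>0. ((\<lambda>s. Y s \<omega>) \<longlongrightarrow> Y t \<omega>) (at_right t)) \<and>
     (\<forall>\<omega>\<in>space \<Omega>. \<forall>t>0. \<exists>\<eta>\<in>space E. ((\<lambda>s. Y s \<omega>) \<longlongrightarrow> \<eta>) (at_left t)) \<and>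
     (\<forall>\<xi>\<in>space E. prob_space (Pr \<xi>) \<and> sets (Pr \<xi>) = sets \<Omega> \<and> (AE \<omega> in Pr \<xi>. Y 0 \<omega> = \<xi>)) \<and>
     (\<forall>\<xi>\<in>space E. \<forall>s\<ge>0. \<forall>t\<ge>0. \<forall>f. continuous_on (space E) f \<longrightarrow>
        (AE \<omega> in Pr \<xi>. real_cond_exp (Pr \<xi>) (past (space \<Omega>) E Y s) (\<lambda>\<omega>'. f (Y (s + t) \<omega>')) \<omega>
                       = P t f (Y s \<omega>)))"

definition invariant_measure ::
  "'w measure \<Rightarrow> ('s \<Rightarrow> 'w measure) \<Rightarrow> (real \<Rightarrow> 'w \<Rightarrow> 's) \<Rightarrow> 's measure \<Rightarrow> bool" where
  "invariant_measure \<Omega> Pr Y \<kappa> \<longleftrightarrow>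
     (\<forall>t\<ge>0. \<forall>B\<in>sets \<kappa>.
        (\<lambda>\<xi>. emeasure (Pr \<xi>) (Y t -` B \<inter> space \<Omega>)) \<in> borel_measurable \<kappa> \<and>
        (\<integral>\<^sup>+ \<xi>. emeasure (Pr \<xi>) (Y t -` B \<inter> space \<Omega>) \<partial>\<kappa>) = emeasure \<kappa> B)"


subsection \<open>The particle system\<close>

type_synonym 'd site = "int ^ 'd"

text \<open>
  Configurations are \<open>bool\<close>-valued, with the product topology; \<open>occ x i\<close> is the number in \<open>{0, 1}\<close>.
  In every sum below, the increments \<open>x + e\<^sup>i\<close>, \<open>x - e\<^sup>i\<close> and \<open>x + e\<^sup>i\<^sup>' - e\<^sup>i\<close> come with a
  factor that vanishes unless they are again configurations, and then they are given by
  \<open>birth\<close>, \<open>death\<close> and \<open>jump\<close>.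
\<close>

type_synonym 'd config = "'d site \<Rightarrow> bool"

definition occ :: "'d::finite config \<Rightarrow> 'd site \<Rightarrow> real" where
  "occ x i = of_bool (x i)"

definition birth :: "'d::finite site \<Rightarrow> 'd config \<Rightarrow> 'd config" where
  "birth i x = x(i := True)"

definition death :: "'d::finite site \<Rightarrow> 'd config \<Rightarrow> 'd config" where
  "death i x = x(i := False)"

definition jump :: "'d::finite site \<Rightarrow> 'd site \<Rightarrow> 'd config \<Rightarrow> 'd config" where
  "jump i i' x = x(i := False, i' := True)"

definition op_L ::
  "real \<Rightarrow> real \<Rightarrow> real \<Rightarrow> ('d::finite site \<Rightarrow> 'd site \<Rightarrow> real) \<Rightarrow> 'd site \<Rightarrow>
   ('d config \<Rightarrow> real) \<Rightarrow> 'd config \<Rightarrow> real" where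
  "op_L \<phi> lam \<mu> \<beta> z g x =
     (\<Sum>\<^sub>\<infinity>(i, i')\<in>{(i, i'). i \<noteq> i' \<and> i' \<noteq> z}.
        occ x i * (1 - occ x i') * \<beta> i i' * (g (jump i i' x) - g x))
   + (\<Sum>\<^sub>\<infinity>i\<in>- {z}.
        occ x i * (1 - occ x z) * \<beta> i z * exp \<phi> * (g (jump i z x) - g x)
      + lam * (1 - occ x i) * (g (birth i x) - g x)
      + \<mu> * occ x i * (g (death i x) - g x))
   + lam * exp \<phi> * (1 - occ x z) * (g (birth z x) - g x)
   + \<mu> * occ x z * (g (death z x) - g x)"

definition op_A ::
  "'d::finite site set \<Rightarrow> ('d site \<Rightarrow> 'd site \<Rightarrow> real) \<Rightarrow>
   ('d site \<times> 'd config \<Rightarrow> real) \<Rightarrow> 'd site \<times> 'd config \<Rightarrow> real" where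
  "op_A T \<tau> f = (\<lambda>(z, x). \<Sum>z'\<in>T. \<tau> z z' * (f (z', x) - f (z, x)))"

definition op_R ::
  "real \<Rightarrow> real \<Rightarrow> real \<Rightarrow> ('d::finite site \<Rightarrow> 'd site \<Rightarrow> real) \<Rightarrow>
   'd site set \<Rightarrow> ('d site \<Rightarrow> 'd site \<Rightarrow> real) \<Rightarrow> ('d site \<Rightarrow> real) \<Rightarrow> ('d site \<Rightarrow> real) \<Rightarrow>
   ('d site \<times> 'd config \<Rightarrow> real) \<Rightarrow> 'd site \<times> 'd config \<Rightarrow> real" where
  "op_R \<phi> lam \<mu> \<beta> T \<tau> \<alpha> \<sigma> f = (\<lambda>(z, x).
     \<alpha> z * op_L \<phi> lam \<mu> \<beta> z (\<lambda>y. f (z, y)) x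
     + \<sigma> z / exp (\<phi> * occ x z) * op_A T \<tau> f (z, x))"

text \<open>
  The seminorm \<open>|||g|||\<close>, with a weight \<open>w\<close> in the sum over pairs of sites.  The seminorm as
  usually written has \<open>w = 1\<close>.  For that weight, a continuous \<open>g\<close> with \<open>|||g||| < \<infinity>\<close> is constant:
  if \<open>x\<close> has a particle at \<open>i\<close> and infinitely many empty sites \<open>i'\<close>, then
  \<open>g (jump i i' x) \<longlonglongrightarrow> g (death i x)\<close> as \<open>i'\<close> runs through them, so summability over \<open>i'\<close> forces
  \<open>g (death i x) = g x\<close>.  The corresponding operator is not densely defined and so generates no
  semigroup (unless \<open>T\<close> is empty).  With the jump rates as weight, \<open>w = \<beta>\<close>, the Lipschitz functions
  include all functions of finitely many sites, and the sums defining \<open>op_L\<close> converge absolutely,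
  uniformly bounded by a multiple of \<open>|||g|||\<close>.
\<close>

definition lip_seminorm ::
  "('d::finite site \<Rightarrow> 'd site \<Rightarrow> real) \<Rightarrow> ('d config \<Rightarrow> real) \<Rightarrow> ennreal" where
  "lip_seminorm w g = (SUP x.
       (\<Sum>\<^sub>\<infinity>i. ennreal (occ x i * \<bar>g (death i x) - g x\<bar>))
     + (\<Sum>\<^sub>\<infinity>i. ennreal ((1 - occ x i) * \<bar>g (birth i x) - g x\<bar>))
     + (\<Sum>\<^sub>\<infinity>(i, i'). ennreal (w i i' * (occ x i * (1 - occ x i') * \<bar>g (jump i i' x) - g x\<bar>))))"

definition C_L :: "('d::finite site \<Rightarrow> 'd site \<Rightarrow> real) \<Rightarrow> ('d config \<Rightarrow> real) set" where
  "C_L w = {g. continuous_on UNIV g \<and> lip_seminorm w g < \<infinity>}"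

definition C_L_T ::
  "('d::finite site \<Rightarrow> 'd site \<Rightarrow> real) \<Rightarrow> 'd site set \<Rightarrow> ('d site \<times> 'd config \<Rightarrow> real) set" where
  "C_L_T w T = {f. continuous_on (T \<times> UNIV) f \<and> (\<forall>z\<in>T. (\<lambda>x. f (z, x)) \<in> C_L w)}"

text \<open>
  The operator on \<open>C(T \<times> {0,1}\<^sup>\<int>\<^sup>d)\<close> with core \<open>C_L_T w T\<close>.  As \<open>C_L_T\<close> takes a supremum of
  sums, not a sum of suprema, membership alone does not make the image continuous;
  hence the explicit requirement on \<open>h\<close>.
\<close>

definition closed_R ::
  "('d::finite site \<Rightarrow> 'd site \<Rightarrow> real) \<Rightarrow>
   real \<Rightarrow> real \<Rightarrow> real \<Rightarrow> ('d site \<Rightarrow> 'd site \<Rightarrow> real) \<Rightarrow>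
   'd site set \<Rightarrow> ('d site \<Rightarrow> 'd site \<Rightarrow> real) \<Rightarrow> ('d site \<Rightarrow> real) \<Rightarrow> ('d site \<Rightarrow> real) \<Rightarrow>
   (('d site \<times> 'd config \<Rightarrow> real) \<times> ('d site \<times> 'd config \<Rightarrow> real)) set" where
  "closed_R w \<phi> lam \<mu> \<beta> T \<tau> \<alpha> \<sigma> =
     graph_closure (T \<times> UNIV)
       {(f, h). f \<in> C_L_T w T \<and> continuous_on (T \<times> UNIV) h \<and>
          (\<forall>\<xi>\<in>T \<times> UNIV. h \<xi> = op_R \<phi> lam \<mu> \<beta> T \<tau> \<alpha> \<sigma> f \<xi>)}"


subsection \<open>The measures\<close>

definition bernoulli_measure :: "real \<Rightarrow> real \<Rightarrow> 'd::finite config measure" where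
  "bernoulli_measure lam \<mu> = PiM UNIV (\<lambda>_. measure_pmf (bernoulli_pmf (lam / (lam + \<mu>))))"

text \<open>The \<open>\<sigma>\<close>-algebra is the Borel one, as there are countably many sites.\<close>

definition state_space :: "'d::finite site set \<Rightarrow> ('d site \<times> 'd config) measure" where
  "state_space T = count_space T \<Otimes>\<^sub>M PiM UNIV (\<lambda>_. count_space UNIV)"

definition kappa ::
  "real \<Rightarrow> real \<Rightarrow> real \<Rightarrow> 'd::finite site set \<Rightarrow> ('d site \<Rightarrow> real) \<Rightarrow>
   ('d site \<times> 'd config) measure" where
  "kappa \<phi> lam \<mu> T \<sigma> =
     density (count_space T \<Otimes>\<^sub>M bernoulli_measure lam \<mu>)
       (\<lambda>(z, x). ennreal (1 / \<sigma> z * exp (\<phi> * occ x z)))"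

lemma sets_bernoulli_measure:
  "sets (bernoulli_measure lam \<mu> :: 'd::finite config measure) = sets (PiM UNIV (\<lambda>_. count_space UNIV))"
  unfolding bernoulli_measure_def by (rule sets_PiM_cong) auto

lemma sets_kappa: "sets (kappa \<phi> lam \<mu> T \<sigma>) = sets (state_space T)"
  unfolding kappa_def state_space_def
  by (simp, rule sets_pair_measure_cong) (simp_all add: sets_bernoulli_measure)

lemma prob_space_bernoulli_measure: "prob_space (bernoulli_measure lam \<mu>)"
  unfolding bernoulli_measure_def by (intro prob_space_PiM prob_space_measure_pmf)

lemma measurable_occ: "(\<lambda>x. occ x z) \<in> borel_measurable (bernoulli_measure lam \<mu>)"
proof -
  have "(\<lambda>x. x z) \<in> measurable (bernoulli_measure lam \<mu>) (count_space UNIV)"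
    unfolding bernoulli_measure_def
    using measurable_component_singleton[of z UNIV "\<lambda>_. measure_pmf (bernoulli_pmf (lam / (lam + \<mu>)))"]
    by simp
  then show ?thesis unfolding occ_def by measurable
qed

text \<open>The set function by which \<open>kappa\<close> is usually given.\<close>

lemma emeasure_kappa:
  fixes T :: "'d::finite site set"
  assumes T: "finite T" and z: "z \<in> T" and \<sigma>: "\<sigma> z > 0"
    and A: "A \<in> sets (bernoulli_measure lam \<mu>)"
  shows "emeasure (kappa \<phi> lam \<mu> T \<sigma>) ({z} \<times> A) =
    ennreal (1 / \<sigma> z) * (\<integral>\<^sup>+ x\<in>A. ennreal (exp (\<phi> * occ x z)) \<partial>bernoulli_measure lam \<mu>)"
proof -
  let ?B = "bernoulli_measure lam \<mu> :: 'd config measure"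
  interpret B: prob_space ?B by (rule prob_space_bernoulli_measure)
  have m: "(\<lambda>(z, x). ennreal (1 / \<sigma> z * exp (\<phi> * occ x z))) \<in> borel_measurable (count_space T \<Otimes>\<^sub>M ?B)"
  proof (rule measurable_pair_measure_countable1)
    show "countable T" using T by (rule countable_finite)
    fix y assume "y \<in> T"
    note measurable_occ[of y lam \<mu>, measurable]
    show "(\<lambda>x. case (y, x) of (z, x) \<Rightarrow> ennreal (1 / \<sigma> z * exp (\<phi> * occ x z))) \<in> borel_measurable ?B"
      unfolding prod.case by measurable
  qed
  have s: "{z} \<times> A \<in> sets (count_space T \<Otimes>\<^sub>M ?B)" using z A by auto
  have "emeasure (kappa \<phi> lam \<mu> T \<sigma>) ({z} \<times> A) =
     (\<integral>\<^sup>+ p. (case p of (z, x) \<Rightarrow> ennreal (1 / \<sigma> z * exp (\<phi> * occ x z))) * indicator ({z} \<times> A) p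
        \<partial>(count_space T \<Otimes>\<^sub>M ?B))"
    unfolding kappa_def by (rule emeasure_density[OF m s])
  also have "\<dots> = (\<integral>\<^sup>+ y. \<integral>\<^sup>+ x. ennreal (1 / \<sigma> y * exp (\<phi> * occ x y)) * indicator ({z} \<times> A) (y, x) \<partial>?B
        \<partial>count_space T)"
    by (subst B.nn_integral_fst[symmetric]) (use m s in \<open>auto intro: borel_measurable_times_ennreal\<close>)
  also have "\<dots> = (\<Sum>y\<in>T. \<integral>\<^sup>+ x. ennreal (1 / \<sigma> y * exp (\<phi> * occ x y)) * indicator ({z} \<times> A) (y, x) \<partial>?B)"
    by (rule nn_integral_count_space_finite[OF T])
  also have "\<dots> = (\<Sum>y\<in>T. if y = z then
       \<integral>\<^sup>+ x. ennreal (1 / \<sigma> z) * (ennreal (exp (\<phi> * occ x z)) * indicator A x) \<partial>?B else 0)"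
    by (rule sum.cong) (use \<sigma> in \<open>auto simp: indicator_def ennreal_mult'[symmetric] intro!: nn_integral_cong\<close>)
  also have "\<dots> = (\<integral>\<^sup>+ x. ennreal (1 / \<sigma> z) * (ennreal (exp (\<phi> * occ x z)) * indicator A x) \<partial>?B)"
    using T z by simp
  also have "\<dots> = ennreal (1 / \<sigma> z) * (\<integral>\<^sup>+ x\<in>A. ennreal (exp (\<phi> * occ x z)) \<partial>?B)"
    by (rule nn_integral_cmult) (use A measurable_occ[of z lam \<mu>] in measurable)
  finally show ?thesis .
qed

end

theory Submission
  imports Defs
begin

text \<open>
  The functional \<open>\<Lambda> f = \<integral> f d\<kappa>\<close> vanishes on the range of the generator.  The weight \<open>e\<^sup>\<phi>\<^sup>x\<^sup>z\<close> turns the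
  rates of the particle dynamics into symmetric ones: exchanges cancel in pairs because the Bernoulli
  measure is invariant under transposition of two sites, and births cancel against deaths at each site.
  The factor \<open>1 / \<sigma>\<close> likewise reduces the motion of the heavy particle to the symmetric rates \<open>\<tau>\<close>.

  For \<open>f\<close> in the domain, \<open>\<Lambda> (P\<^sub>t f)\<close> has derivative 0 in \<open>t\<close>, hence is constant; this extends to all
  continuous \<open>f\<close> as the domain of a generator is dense.  The continuous indicators generate the
  \<open>\<sigma>\<close>-algebra, which gives invariance of the measure.
\<close>

section \<open>Functionals vanishing on the range of a Feller generator\<close>

text \<open>For each fixed z, the measure with density \<open>exp (\<phi> * occ x z)\<close> with
  respect to the Bernoulli measure satisfies detailed balance for \<open>op_L\<close> at z. The time
  scale \<alpha>(z) therefore only multiplies an integral that is already zero. Two obstacles shape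
  the proof. First, the sums in \<open>op_L\<close> are infinite, and opposite jumps cancel only
  after integration; exchanging series and integral rests on the seminorm, which bounds all finite
  partial sums uniformly in the configuration. Second, \<open>P t\<close> is known only through the
  semigroup axioms, with neither a kernel nor a derivative in t. Increments that are o(h) uniformly
  in the base time take the place of differentiation, and time integrals of orbits supply elements
  of the domain. The domain of the generator is never described explicitly: integration against
  kappa is continuous in the sup norm, so vanishing on the images of the core passes to the graph
  closure.\<close>

lemma const_if_increments_small:
  fixes D :: "real \<Rightarrow> real"
  assumes small: "\<And>e. e > 0 \<Longrightarrow> \<exists>d>0. \<forall>a\<ge>0. \<forall>h. 0 < h \<and> h < d \<longrightarrow> \<bar>D (a + h) - D a\<bar> \<le> e * h"
    and t: "t \<ge> 0"
  shows "D t = D 0"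
proof (cases "t = 0")
  case False
  then have tp: "t > 0" using t by simp
  have "\<bar>D t - D 0\<bar> \<le> e" if e: "e > 0" for e
  proof -
    \<comment> \<open>A tolerance e/t per unit of time accumulates to e over [0, t]. The interval is
      cut into n equal steps of length h < d and the increments are telescoped.\<close>
    from small[of "e / t"] e tp obtain d where d: "d > 0"
      and D: "\<And>a h. a \<ge> 0 \<Longrightarrow> 0 < h \<Longrightarrow> h < d \<Longrightarrow> \<bar>D (a + h) - D a\<bar> \<le> e / t * h"
      by force
    obtain n :: nat where n: "t / d < real n" using reals_Archimedean2 by blast
    then have n0: "n > 0" using tp d by (metis divide_pos_pos gr0I less_asym of_nat_0)
    define h where "h = t / real n"
    have h: "0 < h" "h < d" using n n0 tp d by (auto simp: h_def field_simps)
    have "\<bar>D (real k * h) - D 0\<bar> \<le> e / t * (real k * h)" for k :: nat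
    proof (induction k)
      case (Suc k)
      have "\<bar>D (real k * h + h) - D (real k * h)\<bar> \<le> e / t * h"
        using h by (intro D) auto
      moreover have "real (Suc k) * h = real k * h + h" by (simp add: algebra_simps)
      ultimately show ?case using Suc.IH by (simp add: algebra_simps)
    qed simp
    from this[of n] show ?thesis using n0 tp by (simp add: h_def)
  qed
  then have "\<bar>D t - D 0\<bar> \<le> 0" by (rule field_le_epsilon) auto
  then show ?thesis by simp
qed simp

lemma integral_approx_const:
  fixes F :: "real \<Rightarrow> real"
  assumes "F integrable_on {a..a+h}" "0 \<le> h" "\<And>s. a \<le> s \<Longrightarrow> s \<le> a + h \<Longrightarrow> \<bar>F s - c\<bar> \<le> e"
  shows "\<bar>integral {a..a+h} F - h * c\<bar> \<le> e * h"
proof -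
  have "h * (c - e) \<le> integral {a..a+h} F"
    using integral_le[of "\<lambda>_. c - e" "{a..a+h}" F] assms by (auto simp: abs_le_iff algebra_simps)
  moreover have "integral {a..a+h} F \<le> h * (c + e)"
    using integral_le[of F "{a..a+h}" "\<lambda>_. c + e"] assms by (auto simp: abs_le_iff algebra_simps)
  ultimately show ?thesis by (auto simp: abs_le_iff algebra_simps)
qed

section \<open>Contraction and continuity properties of a Feller semigroup\<close>

context
  fixes S :: "'s::topological_space set" and P :: "real \<Rightarrow> ('s \<Rightarrow> real) \<Rightarrow> 's \<Rightarrow> real"
  assumes feller: "feller_semigroup S P"
begin

lemma feller_cont: "t \<ge> 0 \<Longrightarrow> continuous_on S f \<Longrightarrow> continuous_on S (P t f)"
  using feller by (simp add: feller_semigroup_def)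

lemma feller_linear:
  "t \<ge> 0 \<Longrightarrow> continuous_on S f \<Longrightarrow> continuous_on S g \<Longrightarrow> \<xi> \<in> S \<Longrightarrow>
    P t (\<lambda>\<eta>. a * f \<eta> + b * g \<eta>) \<xi> = a * P t f \<xi> + b * P t g \<xi>"
  using feller by (simp add: feller_semigroup_def)

lemma feller_0: "continuous_on S f \<Longrightarrow> \<xi> \<in> S \<Longrightarrow> P 0 f \<xi> = f \<xi>"
  using feller by (simp add: feller_semigroup_def)

lemma feller_add:
  "s \<ge> 0 \<Longrightarrow> t \<ge> 0 \<Longrightarrow> continuous_on S f \<Longrightarrow> \<xi> \<in> S \<Longrightarrow> P (s + t) f \<xi> = P s (P t f) \<xi>"
  using feller by (simp add: feller_semigroup_def)

lemma feller_one: "t \<ge> 0 \<Longrightarrow> \<xi> \<in> S \<Longrightarrow> P t (\<lambda>_. 1) \<xi> = 1"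
  using feller by (simp add: feller_semigroup_def)

lemma feller_pos:
  "t \<ge> 0 \<Longrightarrow> continuous_on S f \<Longrightarrow> (\<And>\<eta>. \<eta> \<in> S \<Longrightarrow> 0 \<le> f \<eta>) \<Longrightarrow> \<xi> \<in> S \<Longrightarrow> 0 \<le> P t f \<xi>"
  using feller by (simp add: feller_semigroup_def)

text \<open>Positivity applied to c + f and c - f, together with \<open>P t 1 = 1\<close>. The
  constant is written \<open>c * 1\<close> below so that it has the shape of a linear
  combination.\<close>

lemma feller_contraction:
  assumes t: "t \<ge> 0" and f: "continuous_on S f" and c: "\<And>\<eta>. \<eta> \<in> S \<Longrightarrow> \<bar>f \<eta>\<bar> \<le> c" and \<xi>: "\<xi> \<in> S"
  shows "\<bar>P t f \<xi>\<bar> \<le> c"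
proof -
  have one: "continuous_on S (\<lambda>_. 1::real)" by simp
  have *: "0 \<le> c * P t (\<lambda>_. 1) \<xi> + b * P t f \<xi>" if b: "\<bar>b\<bar> = 1" for b
  proof -
    have "\<bar>b * f \<eta>\<bar> \<le> c" if "\<eta> \<in> S" for \<eta> using c[OF that] b by (simp add: abs_mult)
    then have "0 \<le> P t (\<lambda>\<eta>. c * 1 + b * f \<eta>) \<xi>"
      by (intro feller_pos[OF t _ _ \<xi>] continuous_intros f) (force simp: abs_le_iff)
    then show ?thesis by (simp only: feller_linear[OF t one f \<xi>])
  qed
  from *[of 1] *[of "-1"] show ?thesis by (simp add: feller_one[OF t \<xi>])
qed

lemma feller_contraction_diff:
  assumes t: "t \<ge> 0" and f: "continuous_on S f" and g: "continuous_on S g"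
    and c: "\<And>\<eta>. \<eta> \<in> S \<Longrightarrow> \<bar>f \<eta> - g \<eta>\<bar> \<le> c" and \<xi>: "\<xi> \<in> S"
  shows "\<bar>P t f \<xi> - P t g \<xi>\<bar> \<le> c"
proof -
  have "P t (\<lambda>\<eta>. 1 * f \<eta> + (-1) * g \<eta>) \<xi> = P t f \<xi> - P t g \<xi>"
    by (subst feller_linear[OF t f g \<xi>]) simp
  then show ?thesis
    using feller_contraction[OF t _ _ \<xi>, of "\<lambda>\<eta>. 1 * f \<eta> + (-1) * g \<eta>" c] f g c
    by (auto intro: continuous_intros)
qed

text \<open>The axioms give only right limits. Since \<open>P (a + s) f - P a f\<close> is
  \<open>P a\<close> applied to \<open>P s f - f\<close>, contraction lets the modulus at time 0
  serve every base time a, and two-sided continuity follows.\<close>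

lemma feller_uniformly_continuous:
  assumes f: "continuous_on S f" and e: "e > 0"
  obtains d where "d > 0"
    "\<And>a s \<xi>. 0 \<le> a \<Longrightarrow> 0 \<le> s \<Longrightarrow> s < d \<Longrightarrow> \<xi> \<in> S \<Longrightarrow> \<bar>P (a + s) f \<xi> - P a f \<xi>\<bar> \<le> e"
proof -
  have "uniform_limit S (\<lambda>s. P s f) (P 0 f) (at_right 0)"
    using feller f by (auto simp: feller_semigroup_def)
  then have "\<forall>\<^sub>F s in at_right 0. \<forall>\<xi>\<in>S. dist (P s f \<xi>) (P 0 f \<xi>) < e"
    using e by (rule uniform_limitD)
  then obtain d where d: "d > 0" and dd: "\<And>s \<xi>. 0 < s \<Longrightarrow> s < d \<Longrightarrow> \<xi> \<in> S \<Longrightarrow> \<bar>P s f \<xi> - f \<xi>\<bar> < e"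
    by (auto simp: eventually_at_right_field dist_real_def feller_0[OF f])
  have d0: "\<bar>P s f \<xi> - f \<xi>\<bar> \<le> e" if "0 \<le> s" "s < d" "\<xi> \<in> S" for s \<xi>
    using dd[of s \<xi>] that e by (cases "s = 0") (auto simp: feller_0[OF f])
  show ?thesis
  proof (rule that[OF d])
    fix a s \<xi> assume a: "0 \<le> (a::real)" and s: "0 \<le> s" "s < d" and \<xi>: "\<xi> \<in> S"
    have "\<bar>P a (P s f) \<xi> - P a f \<xi>\<bar> \<le> e"
      using d0 s by (intro feller_contraction_diff a feller_cont f \<xi>) auto
    then show "\<bar>P (a + s) f \<xi> - P a f \<xi>\<bar> \<le> e"
      by (simp add: feller_add[OF a s(1) f \<xi>])
  qed
qed

text \<open>Joint continuity makes orbits integrable in time and their time integrals continuous in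
  the state.\<close>

lemma feller_jointly_continuous:
  assumes f: "continuous_on S f"
  shows "continuous_on (S \<times> {0..}) (\<lambda>(\<xi>, s). P s f \<xi>)"
  unfolding continuous_on_def
proof (intro ballI tendstoI)
  fix p :: "'s \<times> real" and e :: real assume p: "p \<in> S \<times> {0..}" and e: "0 < e"
  obtain \<xi>0 and s0 :: real where p_eq: "p = (\<xi>0, s0)" and \<xi>0: "\<xi>0 \<in> S" and s0: "s0 \<ge> 0" using p by auto
  obtain d where d: "d > 0" and dd:
    "\<And>a s \<xi>. 0 \<le> a \<Longrightarrow> 0 \<le> s \<Longrightarrow> s < d \<Longrightarrow> \<xi> \<in> S \<Longrightarrow> \<bar>P (a + s) f \<xi> - P a f \<xi>\<bar> \<le> e / 3"
    using feller_uniformly_continuous[OF f, of "e / 3"] e by auto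
  have "((\<lambda>q. P s0 f (fst q)) \<longlongrightarrow> P s0 f \<xi>0) (at p within S \<times> {0..})"
  proof -
    have "continuous_on (S \<times> {0::real..}) (\<lambda>q. P s0 f (fst q))"
      by (rule continuous_on_compose2[OF feller_cont[OF s0 f] continuous_on_fst[OF continuous_on_id]]) auto
    then show ?thesis using p p_eq by (metis continuous_on_def fst_conv)
  qed
  then have "\<forall>\<^sub>F q in at p within S \<times> {0..}. dist (P s0 f (fst q)) (P s0 f \<xi>0) < e / 3"
    using e by (intro tendstoD) auto
  moreover have "((\<lambda>q. snd q) \<longlongrightarrow> s0) (at p within S \<times> {0..})"
    using tendsto_snd[OF tendsto_ident_at, of p] p_eq by simp
  then have "\<forall>\<^sub>F q in at p within S \<times> {0..}. dist (snd q) s0 < d"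
    using d by (intro tendstoD) auto
  moreover have "\<forall>\<^sub>F q in at p within S \<times> {0..}. q \<in> S \<times> {0..}"
    by (simp add: eventually_at_filter)
  ultimately show "\<forall>\<^sub>F q in at p within S \<times> {0..}.
      dist (case q of (\<xi>, s) \<Rightarrow> P s f \<xi>) (case p of (\<xi>, s) \<Rightarrow> P s f \<xi>) < e"
  proof eventually_elim
    case (elim q)
    obtain \<xi> s where q: "q = (\<xi>, s)" "\<xi> \<in> S" "s \<ge> 0" using elim by auto
    have s: "\<bar>s - s0\<bar> < d" and "\<bar>P s0 f \<xi> - P s0 f \<xi>0\<bar> < e / 3"
      using elim q by (auto simp: dist_real_def)
    \<comment> \<open>The modulus is stated for forward increments, so the earlier of s and s0
      serves as base time.\<close>
    moreover have "\<bar>P s f \<xi> - P s0 f \<xi>\<bar> \<le> e / 3"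
      using dd[of s "s0 - s" \<xi>] dd[of s0 "s - s0" \<xi>] s q s0
      by (cases "s \<le> s0") (auto simp: abs_minus_commute)
    ultimately have "\<bar>P s f \<xi> - P s0 f \<xi>0\<bar> < e" using e by linarith
    then show ?case using q p_eq by (simp add: dist_real_def)
  qed
qed

section \<open>Time integrals of orbits and the domain of the generator\<close>

definition orbit_integral :: "('s \<Rightarrow> real) \<Rightarrow> real \<Rightarrow> 's \<Rightarrow> real" where
  "orbit_integral f a \<xi> = integral {0..a} (\<lambda>s. P s f \<xi>)"

lemma orbit_integrable:
  assumes f: "continuous_on S f" and \<xi>: "\<xi> \<in> S" and a: "0 \<le> a"
  shows "(\<lambda>s. P s f \<xi>) integrable_on {a..b}"
proof -
  have "continuous_on {a..b} (\<lambda>s. case (\<xi>, s) of (\<xi>, s) \<Rightarrow> P s f \<xi>)"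
    by (rule continuous_on_compose2[OF feller_jointly_continuous[OF f]])
      (use \<xi> a in \<open>auto intro!: continuous_intros\<close>)
  then show ?thesis by (auto intro: integrable_continuous_real)
qed

lemma orbit_integral_cont:
  assumes f: "continuous_on S f"
  shows "continuous_on S (orbit_integral f a)"
proof -
  have "continuous_on (S \<times> cbox 0 a) (\<lambda>(\<xi>, s). P s f \<xi>)"
    by (rule continuous_on_subset[OF feller_jointly_continuous[OF f]]) auto
  from integral_continuous_on_param[OF this] show ?thesis
    by (simp add: orbit_integral_def[abs_def])
qed

lemma orbit_integral_diff:
  assumes f: "continuous_on S f" and \<xi>: "\<xi> \<in> S" and "0 \<le> a" "0 \<le> h"
  shows "orbit_integral f (a + h) \<xi> - orbit_integral f a \<xi> = integral {a..a+h} (\<lambda>s. P s f \<xi>)"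
  using Henstock_Kurzweil_Integration.integral_combine[of 0 a "a + h" "\<lambda>s. P s f \<xi>"]
    orbit_integrable[OF f \<xi>, of 0] assms(3,4)
  unfolding orbit_integral_def by auto

text \<open>The fundamental theorem of calculus for the upper limit a. The integral is pointwise in
  the state, so the uniformity in \<xi> is what turns it into a statement in the sup norm; the
  uniformity in a is what \<open>const_if_increments_small\<close> asks for.\<close>

lemma orbit_integral_increment:
  assumes f: "continuous_on S f" and e: "e > 0"
  obtains d where "d > 0"
    "\<And>a h \<xi>. 0 \<le> a \<Longrightarrow> 0 \<le> h \<Longrightarrow> h < d \<Longrightarrow> \<xi> \<in> S \<Longrightarrow>
      \<bar>orbit_integral f (a + h) \<xi> - orbit_integral f a \<xi> - h * P a f \<xi>\<bar> \<le> e * h"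
proof -
  obtain d where d: "d > 0" and dd:
    "\<And>a s \<xi>. 0 \<le> a \<Longrightarrow> 0 \<le> s \<Longrightarrow> s < d \<Longrightarrow> \<xi> \<in> S \<Longrightarrow> \<bar>P (a + s) f \<xi> - P a f \<xi>\<bar> \<le> e"
    using feller_uniformly_continuous[OF f e] by metis
  show ?thesis
  proof (rule that[OF d])
    fix a h \<xi> assume *: "0 \<le> (a::real)" "0 \<le> h" "h < d" "\<xi> \<in> S"
    show "\<bar>orbit_integral f (a + h) \<xi> - orbit_integral f a \<xi> - h * P a f \<xi>\<bar> \<le> e * h"
      unfolding orbit_integral_diff[OF f *(4) *(1,2)]
    proof (rule integral_approx_const[OF orbit_integrable[OF f *(4,1)] *(2)])
      fix s assume "a \<le> s" "s \<le> a + h"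
      then show "\<bar>P s f \<xi> - P a f \<xi>\<bar> \<le> e" using dd[of a "s - a" \<xi>] * by auto
    qed
  qed
qed

text \<open>\<open>P t\<close> is only an abstract operator and cannot be moved under the integral
  sign directly. Instead, both sides have the first-order increment
  \<open>h * P (a + t) f \<xi>\<close> as functions of the upper limit a and agree at a = 0, so
  their difference D is constantly 0.\<close>

lemma feller_orbit_integral:
  assumes f: "continuous_on S f" and \<xi>: "\<xi> \<in> S" and t: "0 \<le> t" and a: "0 \<le> a"
  shows "P t (orbit_integral f a) \<xi> = orbit_integral f (a + t) \<xi> - orbit_integral f t \<xi>"
proof -
  define D where "D a = P t (orbit_integral f a) \<xi> - (orbit_integral f (a + t) \<xi> - orbit_integral f t \<xi>)" for a
  note oc = orbit_integral_cont[OF f]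
  have "D a = D 0"
  proof (rule const_if_increments_small[OF _ a])
    fix e :: real assume e: "e > 0"
    obtain d where d: "d > 0" and dd: "\<And>a h \<xi>. 0 \<le> a \<Longrightarrow> 0 \<le> h \<Longrightarrow> h < d \<Longrightarrow> \<xi> \<in> S \<Longrightarrow>
      \<bar>orbit_integral f (a + h) \<xi> - orbit_integral f a \<xi> - h * P a f \<xi>\<bar> \<le> e / 2 * h"
      using orbit_integral_increment[OF f, of "e / 2"] e by auto
    have "\<bar>D (a + h) - D a\<bar> \<le> e * h" if a: "a \<ge> 0" and h: "0 < h" "h < d" for a h
    proof -
      have c: "continuous_on S (\<lambda>\<eta>. 1 * orbit_integral f a \<eta> + h * P a f \<eta>)"
        by (intro continuous_intros oc feller_cont f a)
      have "\<bar>P t (orbit_integral f (a + h)) \<xi> - P t (\<lambda>\<eta>. 1 * orbit_integral f a \<eta> + h * P a f \<eta>) \<xi>\<bar>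
          \<le> e / 2 * h"
      proof (intro feller_contraction_diff t oc c \<xi>)
        fix \<eta> assume "\<eta> \<in> S"
        from dd[OF a less_imp_le[OF h(1)] h(2) this]
        show "\<bar>orbit_integral f (a + h) \<eta> - (1 * orbit_integral f a \<eta> + h * P a f \<eta>)\<bar> \<le> e / 2 * h"
          unfolding mult_1 diff_diff_eq .
      qed
      also have "P t (\<lambda>\<eta>. 1 * orbit_integral f a \<eta> + h * P a f \<eta>) \<xi>
          = P t (orbit_integral f a) \<xi> + h * P (a + t) f \<xi>"
        by (subst feller_linear[OF t oc feller_cont[OF a f] \<xi>])
          (simp add: feller_add[OF t a f \<xi>, unfolded add.commute[of t a]])
      finally have "\<bar>P t (orbit_integral f (a + h)) \<xi> - P t (orbit_integral f a) \<xi> - h * P (a + t) f \<xi>\<bar>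
          \<le> e / 2 * h" by (simp add: algebra_simps)
      moreover have "\<bar>orbit_integral f (a + h + t) \<xi> - orbit_integral f (a + t) \<xi> - h * P (a + t) f \<xi>\<bar>
          \<le> e / 2 * h"
        unfolding add.assoc[of a h t] add.commute[of h t] add.assoc[of a t h, symmetric]
        using a t h \<xi> by (intro dd) auto
      moreover have "e / 2 * h + e / 2 * h = e * h" by simp
      ultimately show ?thesis unfolding D_def by linarith
    qed
    with d show "\<exists>d>0. \<forall>a\<ge>0. \<forall>h. 0 < h \<and> h < d \<longrightarrow> \<bar>D (a + h) - D a\<bar> \<le> e * h" by blast
  qed
  moreover have "D 0 = 0"
  proof -
    have "\<bar>P t (orbit_integral f 0) \<xi>\<bar> \<le> 0"
      by (intro feller_contraction t oc \<xi>) (simp add: orbit_integral_def)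
    then show ?thesis by (simp add: D_def)
  qed
  ultimately show ?thesis by (simp add: D_def)
qed

text \<open>By the shift formula, \<open>P t\<close> changes the integral over [0, a] by the
  integral over [a, a + t] minus the one over [0, t]. After division by t these tend to
  \<open>P a f\<close> and f.\<close>

lemma orbit_integral_generator:
  assumes f: "continuous_on S f" and a: "0 \<le> a"
  shows "(orbit_integral f a, \<lambda>\<xi>. P a f \<xi> - f \<xi>) \<in> generator S P"
proof -
  have "uniform_limit S (\<lambda>t \<xi>. (P t (orbit_integral f a) \<xi> - orbit_integral f a \<xi>) / t)
      (\<lambda>\<xi>. P a f \<xi> - f \<xi>) (at_right 0)"
  proof (rule uniform_limitI)
    fix e :: real assume e: "e > 0"
    obtain d where d: "d > 0" and dd: "\<And>a h \<xi>. 0 \<le> a \<Longrightarrow> 0 \<le> h \<Longrightarrow> h < d \<Longrightarrow> \<xi> \<in> S \<Longrightarrow>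
      \<bar>orbit_integral f (a + h) \<xi> - orbit_integral f a \<xi> - h * P a f \<xi>\<bar> \<le> e / 3 * h"
      using orbit_integral_increment[OF f, of "e / 3"] e by auto
    have "dist ((P t (orbit_integral f a) \<xi> - orbit_integral f a \<xi>) / t) (P a f \<xi> - f \<xi>) < e"
      if t: "0 < t" "t < d" and \<xi>: "\<xi> \<in> S" for t \<xi>
    proof -
      have "orbit_integral f 0 \<xi> = 0" by (simp add: orbit_integral_def)
      then have 1: "\<bar>orbit_integral f t \<xi> - t * f \<xi>\<bar> \<le> e / 3 * t"
        using dd[of 0 t \<xi>] t \<xi> by (simp add: feller_0[OF f \<xi>])
      have 2: "\<bar>orbit_integral f (a + t) \<xi> - orbit_integral f a \<xi> - t * P a f \<xi>\<bar> \<le> e / 3 * t"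
        using t \<xi> a by (intro dd) auto
      have "P t (orbit_integral f a) \<xi> = orbit_integral f (a + t) \<xi> - orbit_integral f t \<xi>"
        using t by (intro feller_orbit_integral f \<xi> a) auto
      then have "(P t (orbit_integral f a) \<xi> - orbit_integral f a \<xi>) - t * (P a f \<xi> - f \<xi>)
          = (orbit_integral f (a + t) \<xi> - orbit_integral f a \<xi> - t * P a f \<xi>)
            - (orbit_integral f t \<xi> - t * f \<xi>)"
        by (simp add: algebra_simps)
      with 1 2 have "\<bar>(P t (orbit_integral f a) \<xi> - orbit_integral f a \<xi>) - t * (P a f \<xi> - f \<xi>)\<bar>
          \<le> 2 * (e / 3 * t)" by linarith
      also have "\<dots> < e * t" using e t by simp
      finally have "\<bar>((P t (orbit_integral f a) \<xi> - orbit_integral f a \<xi>) - t * (P a f \<xi> - f \<xi>)) / t\<bar> < e"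
        using t by (simp add: abs_divide pos_divide_less_eq)
      then show ?thesis using t by (simp add: dist_real_def diff_divide_distrib)
    qed
    then show "\<forall>\<^sub>F t in at_right 0. \<forall>\<xi>\<in>S.
        dist ((P t (orbit_integral f a) \<xi> - orbit_integral f a \<xi>) / t) (P a f \<xi> - f \<xi>) < e"
      using d unfolding eventually_at_right_field by blast
  qed
  then show ?thesis
    using f a by (auto simp: generator_def intro!: orbit_integral_cont continuous_intros feller_cont)
qed

text \<open>The difference quotient of \<open>P t f\<close> is \<open>P t\<close> applied to that of
  f, and a contraction preserves uniform limits.\<close>

lemma generator_commute:
  assumes fh: "(f, h) \<in> generator S P" and t: "0 \<le> t"
  shows "(P t f, P t h) \<in> generator S P"
proof -
  have f: "continuous_on S f" and h: "continuous_on S h"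
    and lim: "uniform_limit S (\<lambda>s \<xi>. (P s f \<xi> - f \<xi>) / s) h (at_right 0)"
    using fh by (auto simp: generator_def)
  have "uniform_limit S (\<lambda>s \<xi>. (P s (P t f) \<xi> - P t f \<xi>) / s) (P t h) (at_right 0)"
  proof (rule uniform_limitI)
    fix e :: real assume e: "e > 0"
    have "\<forall>\<^sub>F s in at_right 0. \<forall>\<xi>\<in>S. dist ((P s f \<xi> - f \<xi>) / s) (h \<xi>) < e / 2"
      using e by (intro uniform_limitD[OF lim]) auto
    moreover have "\<forall>\<^sub>F s::real in at_right 0. 0 < s" by (simp add: eventually_at_filter)
    ultimately show "\<forall>\<^sub>F s in at_right 0. \<forall>\<xi>\<in>S.
        dist ((P s (P t f) \<xi> - P t f \<xi>) / s) (P t h \<xi>) < e"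
    proof eventually_elim
      case (elim s)
      then have s: "0 \<le> s" by simp
      show ?case
      proof
        fix \<xi> assume \<xi>: "\<xi> \<in> S"
        let ?q = "\<lambda>\<eta>. 1 / s * P s f \<eta> + (- 1 / s) * f \<eta>"
        have "\<bar>P t ?q \<xi> - P t h \<xi>\<bar> \<le> e / 2"
          by (intro feller_contraction_diff t h \<xi> continuous_intros feller_cont s f)
            (use elim in \<open>auto simp: dist_real_def diff_divide_distrib less_imp_le\<close>)
        also have "P t ?q \<xi> = 1 / s * P t (P s f) \<xi> + (- 1 / s) * P t f \<xi>"
          by (rule feller_linear[OF t feller_cont[OF s f] f \<xi>])
        also have "P t (P s f) \<xi> = P s (P t f) \<xi>"
          using feller_add[OF t s f \<xi>] feller_add[OF s t f \<xi>] by (simp add: add.commute)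
        finally show "dist ((P s (P t f) \<xi> - P t f \<xi>) / s) (P t h \<xi>) < e"
          using e by (simp add: dist_real_def diff_divide_distrib)
      qed
    qed
  qed
  then show ?thesis using f h t by (auto simp: generator_def intro!: feller_cont)
qed

section \<open>Bounded functionals that annihilate the range of the generator\<close>

context
  fixes \<Lambda> :: "('s \<Rightarrow> real) \<Rightarrow> real" and C :: real
  assumes \<Lambda>_linear: "\<And>f g a b. continuous_on S f \<Longrightarrow> continuous_on S g \<Longrightarrow>
      \<Lambda> (\<lambda>\<eta>. a * f \<eta> + b * g \<eta>) = a * \<Lambda> f + b * \<Lambda> g"
    and \<Lambda>_bounded: "\<And>f c. continuous_on S f \<Longrightarrow> (\<And>\<eta>. \<eta> \<in> S \<Longrightarrow> \<bar>f \<eta>\<bar> \<le> c) \<Longrightarrow> 0 \<le> c \<Longrightarrow> \<bar>\<Lambda> f\<bar> \<le> C * c"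
    and \<Lambda>_generator: "\<And>f h. (f, h) \<in> generator S P \<Longrightarrow> \<Lambda> h = 0"
begin

lemma functional_diff_bounded:
  assumes "continuous_on S f" "continuous_on S g" "\<And>\<eta>. \<eta> \<in> S \<Longrightarrow> \<bar>f \<eta> - g \<eta>\<bar> \<le> c" "0 \<le> c"
  shows "\<bar>\<Lambda> f - \<Lambda> g\<bar> \<le> C * c"
proof -
  have "\<bar>\<Lambda> (\<lambda>\<eta>. 1 * f \<eta> + (-1) * g \<eta>)\<bar> \<le> C * c"
    using assms by (intro \<Lambda>_bounded continuous_intros) auto
  then show ?thesis using \<Lambda>_linear[OF assms(1,2), of 1 "-1"] by simp
qed

lemma functional_bound_nonneg: "0 \<le> C"
  using \<Lambda>_bounded[of "\<lambda>_. 0" 1] by auto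

text \<open>To first order, \<open>P (a + s) f\<close> is \<open>P a f + s * P a h\<close>. The
  second term is annihilated because \<open>P a h\<close> lies in the range of the generator
  again.\<close>

lemma functional_invariant_domain:
  assumes fh: "(f, h) \<in> generator S P" and t: "0 \<le> t"
  shows "\<Lambda> (P t f) = \<Lambda> f"
proof -
  have f: "continuous_on S f" and h: "continuous_on S h"
    and lim: "uniform_limit S (\<lambda>s \<xi>. (P s f \<xi> - f \<xi>) / s) h (at_right 0)"
    using fh by (auto simp: generator_def)
  have "\<Lambda> (P t f) = \<Lambda> (P 0 f)"
  proof (rule const_if_increments_small[OF _ t])
    fix e :: real assume e: "e > 0"
    \<comment> \<open>The summand 1 keeps the quotient meaningful for C = 0.\<close>
    define e' where "e' = e / (C + 1)"
    have e': "e' > 0" "C * e' \<le> e"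
      using e functional_bound_nonneg by (auto simp: e'_def field_simps add_pos_nonneg)
    have "\<forall>\<^sub>F s in at_right 0. \<forall>\<xi>\<in>S. dist ((P s f \<xi> - f \<xi>) / s) (h \<xi>) < e'"
      using e' by (intro uniform_limitD[OF lim]) auto
    then obtain d where d: "d > 0"
      and dd: "\<And>s \<xi>. 0 < s \<Longrightarrow> s < d \<Longrightarrow> \<xi> \<in> S \<Longrightarrow> \<bar>(P s f \<xi> - f \<xi>) / s - h \<xi>\<bar> < e'"
      by (auto simp: eventually_at_right_field dist_real_def)
    have "\<bar>\<Lambda> (P (a + s) f) - \<Lambda> (P a f)\<bar> \<le> e * s" if a: "a \<ge> 0" and s: "0 < s" "s < d" for a s
    proof -
      have s0: "0 \<le> s" using s by simp
      let ?g = "\<lambda>\<eta>. 1 * f \<eta> + s * h \<eta>" and ?Pg = "\<lambda>\<eta>. 1 * P a f \<eta> + s * P a h \<eta>"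
      have close: "\<bar>P s f \<eta> - ?g \<eta>\<bar> \<le> e' * s" if "\<eta> \<in> S" for \<eta>
      proof -
        have "P s f \<eta> - ?g \<eta> = s * ((P s f \<eta> - f \<eta>) / s - h \<eta>)" using s by (simp add: field_simps)
        then have "\<bar>P s f \<eta> - ?g \<eta>\<bar> = s * \<bar>(P s f \<eta> - f \<eta>) / s - h \<eta>\<bar>" using s by (simp add: abs_mult)
        also have "\<dots> \<le> s * e'" using dd[OF s that] s by (intro mult_left_mono) auto
        finally show ?thesis by (simp add: mult.commute)
      qed
      have "\<bar>P (a + s) f \<eta> - ?Pg \<eta>\<bar> \<le> e' * s" if \<eta>: "\<eta> \<in> S" for \<eta>
      proof -
        have "\<bar>P a (P s f) \<eta> - P a ?g \<eta>\<bar> \<le> e' * s"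
          by (intro feller_contraction_diff a feller_cont s0 f h \<eta> continuous_intros close)
        then show ?thesis
          by (simp only: feller_add[OF a s0 f \<eta>] feller_linear[OF a f h \<eta>])
      qed
      then have "\<bar>\<Lambda> (P (a + s) f) - \<Lambda> ?Pg\<bar> \<le> C * (e' * s)"
        using a s e' by (intro functional_diff_bounded feller_cont f h continuous_intros) auto
      also have "\<Lambda> ?Pg = \<Lambda> (P a f)"
        using \<Lambda>_linear[OF feller_cont[OF a f] feller_cont[OF a h], of 1 s]
          \<Lambda>_generator[OF generator_commute[OF fh a]] by simp
      also have "C * (e' * s) \<le> e * s"
        using mult_right_mono[OF e'(2) s0] by (simp add: mult.assoc)
      finally show ?thesis .
    qed
    with d show "\<exists>d>0. \<forall>a\<ge>0. \<forall>s. 0 < s \<and> s < d \<longrightarrow> \<bar>\<Lambda> (P (a + s) f) - \<Lambda> (P a f)\<bar> \<le> e * s"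
      by blast
  qed
  moreover have "\<bar>\<Lambda> (P 0 f) - \<Lambda> f\<bar> \<le> C * 0"
    by (intro functional_diff_bounded feller_cont f) (auto simp: feller_0[OF f])
  ultimately show ?thesis by simp
qed

text \<open>The averages \<open>orbit_integral f a / a\<close> lie in the domain of the generator and tend to \<open>f\<close>
  as \<open>a\<close> tends to 0, so the domain is dense.\<close>

theorem functional_invariant:
  assumes f: "continuous_on S f" and t: "0 \<le> t"
  shows "\<Lambda> (P t f) = \<Lambda> f"
proof -
  have "\<bar>\<Lambda> (P t f) - \<Lambda> f\<bar> \<le> e" if e: "e > 0" for e
  proof -
    \<comment> \<open>Replacing f by the average costs at most \<open>C * e'\<close> at time 0 and
      again at time t.\<close>
    define e' where "e' = e / (2 * C + 1)"
    have e': "e' > 0" "2 * C * e' \<le> e"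
      using e functional_bound_nonneg by (auto simp: e'_def field_simps add_pos_nonneg)
    obtain d where d: "d > 0" and dd: "\<And>a h \<xi>. 0 \<le> a \<Longrightarrow> 0 \<le> h \<Longrightarrow> h < d \<Longrightarrow> \<xi> \<in> S \<Longrightarrow>
      \<bar>orbit_integral f (a + h) \<xi> - orbit_integral f a \<xi> - h * P a f \<xi>\<bar> \<le> e' * h"
      using orbit_integral_increment[OF f e'(1)] by auto
    define a where "a = d / 2"
    have a: "0 < a" "a < d" using d by (auto simp: a_def)
    define g where "g = orbit_integral f a"
    have g: "continuous_on S g" unfolding g_def by (rule orbit_integral_cont[OF f])
    have zero: "continuous_on S (\<lambda>_. 0::real)" by simp
    \<comment> \<open>The summand \<open>0 * 0\<close> gives the average the form of a linear
      combination with the zero function, as the linearity rules require.\<close>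
    have close: "\<bar>f \<eta> - (1 / a * g \<eta> + 0 * 0)\<bar> \<le> e'" if "\<eta> \<in> S" for \<eta>
    proof -
      have "\<bar>g \<eta> - a * f \<eta>\<bar> \<le> e' * a"
        using dd[of 0 a \<eta>] a that
        by (simp add: g_def feller_0[OF f that]) (simp add: orbit_integral_def)
      then have "\<bar>(a * f \<eta> - g \<eta>) / a\<bar> \<le> e'"
        using a by (simp add: abs_divide pos_divide_le_eq abs_minus_commute)
      then show ?thesis using a by (simp add: diff_divide_distrib)
    qed
    have "\<bar>P t f \<eta> - (1 / a * P t g \<eta> + 0 * 0)\<bar> \<le> e'" if \<eta>: "\<eta> \<in> S" for \<eta>
    proof -
      have "\<bar>P t f \<eta> - P t (\<lambda>\<eta>. 1 / a * g \<eta> + 0 * 0) \<eta>\<bar> \<le> e'"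
        by (intro feller_contraction_diff t f g \<eta> continuous_intros close)
      then show ?thesis by (simp only: feller_linear[OF t g zero \<eta>])
    qed
    then have 1: "\<bar>\<Lambda> (P t f) - \<Lambda> (\<lambda>\<eta>. 1 / a * P t g \<eta> + 0 * 0)\<bar> \<le> C * e'"
      using e' by (intro functional_diff_bounded feller_cont f g t continuous_intros) auto
    have 2: "\<bar>\<Lambda> f - \<Lambda> (\<lambda>\<eta>. 1 / a * g \<eta> + 0 * 0)\<bar> \<le> C * e'"
      using e' by (intro functional_diff_bounded f g continuous_intros close) auto
    have 3: "\<Lambda> (P t g) = \<Lambda> g"
      unfolding g_def using a
      by (intro functional_invariant_domain[OF orbit_integral_generator[OF f] t]) simp
    have "\<Lambda> (\<lambda>\<eta>. 1 / a * P t g \<eta> + 0 * 0) = 1 / a * \<Lambda> g" "\<Lambda> (\<lambda>\<eta>. 1 / a * g \<eta> + 0 * 0) = 1 / a * \<Lambda> g"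
      using \<Lambda>_linear[OF feller_cont[OF t g] zero, of "1 / a" 0] \<Lambda>_linear[OF g zero, of "1 / a" 0] 3 by simp_all
    with 1 2 e'(2) show ?thesis by (auto simp: abs_le_iff)
  qed
  then have "\<bar>\<Lambda> (P t f) - \<Lambda> f\<bar> \<le> 0" by (rule field_le_epsilon) auto
  then show ?thesis by simp
qed

end

end


section \<open>From functionals to invariant measures\<close>

lemma subalgebra_past:
  assumes Y: "\<And>t. t \<ge> 0 \<Longrightarrow> Y t \<in> measurable \<Omega> E" and M: "sets M = sets \<Omega>"
  shows "subalgebra M (past (space \<Omega>) E Y s)"
proof -
  let ?A = "{Y u -` B \<inter> space \<Omega> | u B. 0 \<le> u \<and> u \<le> s \<and> B \<in> sets E}"
  have sub: "?A \<subseteq> sets \<Omega>" using Y by (auto intro: measurable_sets)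
  then have pow: "?A \<subseteq> Pow (space \<Omega>)" using sets.space_closed by blast
  have "sigma_sets (space \<Omega>) ?A \<subseteq> sets \<Omega>" using sub by (rule sets.sigma_sets_subset)
  then show ?thesis
    unfolding subalgebra_def past_def
    by (simp add: M sets_eq_imp_space_eq[OF M] space_measure_of[OF pow] sets_measure_of[OF pow])
qed

text \<open>This is the Markov property at s = 0, where the process sits almost surely at its
  starting point; taking expectations removes the conditioning.\<close>

lemma feller_process_expectation:
  fixes f :: "'s::topological_space \<Rightarrow> real"
  assumes proc: "feller_process P E \<Omega> Pr Y" and \<xi>: "\<xi> \<in> space E" and t: "t \<ge> 0"
    and f: "continuous_on (space E) f" and fm: "f \<in> borel_measurable E"
    and bounded: "\<And>\<eta>. \<eta> \<in> space E \<Longrightarrow> \<bar>f \<eta>\<bar> \<le> c"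
  shows "(\<integral>\<omega>. f (Y t \<omega>) \<partial>Pr \<xi>) = P t f \<xi>"
proof -
  have Y: "\<And>t. t \<ge> 0 \<Longrightarrow> Y t \<in> measurable \<Omega> E"
    and prob: "prob_space (Pr \<xi>)" and sets: "sets (Pr \<xi>) = sets \<Omega>"
    and start: "AE \<omega> in Pr \<xi>. Y 0 \<omega> = \<xi>"
    using proc \<xi> by (auto simp: feller_process_def)
  have cond: "AE \<omega> in Pr \<xi>. real_cond_exp (Pr \<xi>) (past (space \<Omega>) E Y 0) (\<lambda>\<omega>'. f (Y (0 + t) \<omega>')) \<omega>
      = P t f (Y 0 \<omega>)"
    using proc \<xi> t f unfolding feller_process_def by blast
  interpret prob_space "Pr \<xi>" by (rule prob)
  interpret past: finite_measure_subalgebra "Pr \<xi>" "past (space \<Omega>) E Y 0"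
    by unfold_locales (rule subalgebra_past[OF Y sets])
  have Yt: "Y t \<in> measurable (Pr \<xi>) E" using Y[OF t] sets by (simp cong: measurable_cong_sets)
  have int: "integrable (Pr \<xi>) (\<lambda>\<omega>. f (Y t \<omega>))"
    by (rule integrable_const_bound[of _ c])
      (use bounded measurable_space[OF Yt] measurable_compose[OF Yt fm] in auto)
  have "(\<integral>\<omega>. f (Y t \<omega>) \<partial>Pr \<xi>)
      = (\<integral>\<omega>. real_cond_exp (Pr \<xi>) (past (space \<Omega>) E Y 0) (\<lambda>\<omega>'. f (Y t \<omega>')) \<omega> \<partial>Pr \<xi>)"
    using past.real_cond_exp_int(2)[OF int] by simp
  also have "\<dots> = (\<integral>\<omega>. P t f \<xi> \<partial>Pr \<xi>)"
    by (rule integral_cong_AE) (use cond start in \<open>auto\<close>)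
  finally show ?thesis by (simp add: prob_space)
qed

text \<open>For a set with continuous indicator the transition probability is \<open>P t\<close> of
  that indicator, so the functional identity applies to it. Such sets are closed under intersection
  and generate the \<sigma>-algebra, and a Dynkin argument reaches all measurable sets.\<close>

lemma invariant_measureI:
  fixes E :: "'s::topological_space measure"
  assumes proc: "feller_process P E \<Omega> Pr Y"
    and finite: "finite_measure \<kappa>" and sets: "sets \<kappa> = sets E"
    and meas: "\<And>f :: 's \<Rightarrow> real. continuous_on (space E) f \<Longrightarrow> f \<in> borel_measurable E"
    and gen: "sets E = sigma_sets (space E)
      {B. B \<subseteq> space E \<and> continuous_on (space E) (indicator B :: 's \<Rightarrow> real)}"
    and cont: "\<And>t f. t \<ge> 0 \<Longrightarrow> continuous_on (space E) f \<Longrightarrow> continuous_on (space E) (P t f)"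
    and inv: "\<And>t f. t \<ge> 0 \<Longrightarrow> continuous_on (space E) f \<Longrightarrow> (\<integral>\<xi>. P t f \<xi> \<partial>\<kappa>) = (\<integral>\<xi>. f \<xi> \<partial>\<kappa>)"
  shows "invariant_measure \<Omega> Pr Y \<kappa>"
  unfolding invariant_measure_def
proof (intro allI impI ballI)
  fix t :: real and B assume t: "0 \<le> t" and "B \<in> sets \<kappa>"
  let ?S = "space E"
  let ?G = "{B. B \<subseteq> ?S \<and> continuous_on ?S (indicator B :: 's \<Rightarrow> real)}"
  interpret finite_measure \<kappa> by (rule finite)
  have space: "space \<kappa> = ?S" using sets by (rule sets_eq_imp_space_eq)
  have prob: "prob_space (Pr \<xi>)" and sets_Pr: "sets (Pr \<xi>) = sets \<Omega>" if "\<xi> \<in> ?S" for \<xi>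
    using proc that by (auto simp: feller_process_def)
  have space_Pr: "space (Pr \<xi>) = space \<Omega>" if "\<xi> \<in> ?S" for \<xi>
    using sets_Pr[OF that] by (rule sets_eq_imp_space_eq)
  have Y: "Y t \<in> measurable \<Omega> E" using proc t by (auto simp: feller_process_def)
  have Y_Pr: "Y t \<in> measurable (Pr \<xi>) E" if "\<xi> \<in> ?S" for \<xi>
    using Y sets_Pr[OF that] by (simp cong: measurable_cong_sets)
  define Q where "Q B \<xi> = emeasure (Pr \<xi>) (Y t -` B \<inter> space \<Omega>)" for B \<xi>
  have Y_sets: "Y t -` B \<inter> space \<Omega> \<in> sets (Pr \<xi>)" if "B \<in> sets E" "\<xi> \<in> ?S" for B \<xi>
    using measurable_sets[OF Y that(1)] sets_Pr[OF that(2)] by simp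
  have "Int_stable ?G"
  proof (rule Int_stableI)
    fix A B assume *: "A \<in> ?G" "B \<in> ?G"
    have "(indicator (A \<inter> B) :: 's \<Rightarrow> real) = (\<lambda>x. indicator A x * indicator B x)"
      by (auto simp: indicator_def fun_eq_iff)
    with * show "A \<inter> B \<in> ?G" by (auto intro!: continuous_intros)
  qed
  moreover have "?G \<subseteq> Pow ?S" by auto
  moreover have "B \<in> sigma_sets ?S ?G" using \<open>B \<in> sets \<kappa>\<close> sets gen by simp
  \<comment> \<open>Measurability in the starting point is carried through the induction together
    with the identity: \<open>feller_process\<close> does not state it, and the complement and union
    steps integrate Q.\<close>
  ultimately have "Q B \<in> borel_measurable \<kappa> \<and> (\<integral>\<^sup>+\<xi>. Q B \<xi> \<partial>\<kappa>) = emeasure \<kappa> B"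
  proof (induction B rule: sigma_sets_induct_disjoint)
    case (basic B)
    let ?f = "indicator B :: 's \<Rightarrow> real"
    have f: "continuous_on ?S ?f" and B: "B \<subseteq> ?S" using basic by auto
    have fm: "?f \<in> borel_measurable E" using f by (rule meas)
    have "?f -` {1} \<inter> ?S \<in> sets E" using fm by measurable
    also have "?f -` {1} \<inter> ?S = B" using B by (auto simp: indicator_def)
    finally have BE: "B \<in> sets E" .
    have Q: "P t ?f \<xi> = measure (Pr \<xi>) (Y t -` B \<inter> space \<Omega>)" "Q B \<xi> = ennreal (P t ?f \<xi>)"
      if \<xi>: "\<xi> \<in> ?S" for \<xi>
    proof -
      interpret P: prob_space "Pr \<xi>" by (rule prob[OF \<xi>])
      have "P t ?f \<xi> = (\<integral>\<omega>. ?f (Y t \<omega>) \<partial>Pr \<xi>)"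
        by (rule feller_process_expectation[OF proc \<xi> t f fm, symmetric, where c = 1]) (simp add: indicator_def)
      also have "\<dots> = (\<integral>\<omega>. indicator (Y t -` B \<inter> space \<Omega>) \<omega> \<partial>Pr \<xi>)"
        by (rule Bochner_Integration.integral_cong) (auto simp: space_Pr[OF \<xi>] indicator_def)
      also have "\<dots> = measure (Pr \<xi>) (Y t -` B \<inter> space \<Omega>)"
        by (simp add: space_Pr[OF \<xi>, symmetric])
      finally show "P t ?f \<xi> = measure (Pr \<xi>) (Y t -` B \<inter> space \<Omega>)" .
      then show "Q B \<xi> = ennreal (P t ?f \<xi>)"
        by (simp add: Q_def P.emeasure_eq_measure)
    qed
    have Pm: "P t ?f \<in> borel_measurable \<kappa>"
      using meas[OF cont[OF t f]] by (simp add: measurable_cong_sets[OF sets refl])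
    have Q_01: "0 \<le> P t ?f \<xi>" "P t ?f \<xi> \<le> 1" if "\<xi> \<in> ?S" for \<xi>
      using Q(1)[OF that] prob[OF that] by (auto simp: prob_space.prob_le_1)
    have "Q B \<in> borel_measurable \<kappa>"
      using Pm Q(2) by (subst measurable_cong[where g = "\<lambda>\<xi>. ennreal (P t ?f \<xi>)"]) (auto simp: space)
    moreover have "(\<integral>\<^sup>+\<xi>. Q B \<xi> \<partial>\<kappa>) = (\<integral>\<^sup>+\<xi>. ennreal (P t ?f \<xi>) \<partial>\<kappa>)"
      using Q(2) by (intro nn_integral_cong) (auto simp: space)
    moreover have "\<dots> = ennreal (\<integral>\<xi>. P t ?f \<xi> \<partial>\<kappa>)"
      using Q_01 Pm by (intro nn_integral_eq_integral integrable_const_bound[of _ 1]) (auto simp: space)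
    moreover have "\<dots> = ennreal (measure \<kappa> B)"
      using BE B by (simp add: inv[OF t f] space Int_absorb2 sets)
    ultimately show ?case by (simp add: emeasure_eq_measure)
  next
    case empty
    show ?case by (simp add: Q_def)
  next
    case (compl A)
    then have A: "A \<in> sets E" by (simp add: gen)
    have Q: "Q (?S - A) \<xi> = 1 - Q A \<xi>" "Q A \<xi> \<le> 1" if \<xi>: "\<xi> \<in> ?S" for \<xi>
    proof -
      interpret P: prob_space "Pr \<xi>" by (rule prob[OF \<xi>])
      have "Y t -` (?S - A) \<inter> space \<Omega> = space (Pr \<xi>) - (Y t -` A \<inter> space \<Omega>)"
        using measurable_space[OF Y] by (auto simp: space_Pr[OF \<xi>])
      then show "Q (?S - A) \<xi> = 1 - Q A \<xi>"
        using Y_sets[OF A \<xi>] by (simp add: Q_def emeasure_compl P.emeasure_space_1)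
      show "Q A \<xi> \<le> 1" by (simp add: Q_def P.emeasure_eq_measure)
    qed
    have "Q (?S - A) \<in> borel_measurable \<kappa>"
      using compl by (subst measurable_cong[where g = "\<lambda>\<xi>. 1 - Q A \<xi>"]) (auto simp: space Q)
    moreover have "(\<integral>\<^sup>+\<xi>. Q (?S - A) \<xi> \<partial>\<kappa>) = (\<integral>\<^sup>+\<xi>. 1 - Q A \<xi> \<partial>\<kappa>)"
      by (intro nn_integral_cong) (auto simp: space Q)
    \<comment> \<open>The subtraction is legitimate because the measure is finite.\<close>
    moreover have "\<dots> = emeasure \<kappa> ?S - emeasure \<kappa> A"
      using compl Q(2) by (subst nn_integral_diff) (auto simp: space[symmetric])
    ultimately show ?case using A by (simp add: emeasure_compl sets space[symmetric])
  next
    case (union A)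
    then have A: "\<And>i. A i \<in> sets E" unfolding gen by blast
    have Q: "Q (\<Union>i. A i) \<xi> = (\<Sum>i. Q (A i) \<xi>)" if \<xi>: "\<xi> \<in> ?S" for \<xi>
    proof -
      have "disjoint_family (\<lambda>i. Y t -` A i \<inter> space \<Omega>)"
        using union(1) unfolding disjoint_family_on_def by blast
      moreover have "Y t -` (\<Union>i. A i) \<inter> space \<Omega> = (\<Union>i. Y t -` A i \<inter> space \<Omega>)" by auto
      ultimately show ?thesis
        using Y_sets[OF A \<xi>] by (simp add: Q_def suminf_emeasure image_subset_iff)
    qed
    have QA: "\<And>i. Q (A i) \<in> borel_measurable \<kappa>" "\<And>i. (\<integral>\<^sup>+\<xi>. Q (A i) \<xi> \<partial>\<kappa>) = emeasure \<kappa> (A i)"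
      using union by auto
    have "Q (\<Union>i. A i) \<in> borel_measurable \<kappa>"
      using borel_measurable_suminf_order[of "\<lambda>i. Q (A i)", OF QA(1)] by (subst measurable_cong[where g = "\<lambda>\<xi>. \<Sum>i. Q (A i) \<xi>"]) (auto simp: space Q)
    moreover have "(\<integral>\<^sup>+\<xi>. Q (\<Union>i. A i) \<xi> \<partial>\<kappa>) = (\<integral>\<^sup>+\<xi>. (\<Sum>i. Q (A i) \<xi>) \<partial>\<kappa>)"
      by (intro nn_integral_cong) (auto simp: space Q)
    moreover have "\<dots> = (\<Sum>i. emeasure \<kappa> (A i))"
      using QA by (subst nn_integral_suminf) auto
    moreover have "\<dots> = emeasure \<kappa> (\<Union>i. A i)"
      using A union(1) by (intro suminf_emeasure) (auto simp: sets)
    ultimately show ?case by simp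
  qed
  then show "(\<lambda>\<xi>. emeasure (Pr \<xi>) (Y t -` B \<inter> space \<Omega>)) \<in> borel_measurable \<kappa> \<and>
      (\<integral>\<^sup>+\<xi>. emeasure (Pr \<xi>) (Y t -` B \<inter> space \<Omega>) \<partial>\<kappa>) = emeasure \<kappa> B"
    by (simp add: Q_def[abs_def])
qed


section \<open>The Bernoulli measure\<close>

text \<open>Second countability of the factors identifies the product \<sigma>-algebra over the
  countable set of sites with the Borel one in \<open>config_borel\<close>.\<close>

instance bool :: second_countable_topology
proof
  show "\<exists>B :: bool set set. countable B \<and> open = generate_topology B"
    using open_bool_def by (intro exI conjI) (auto intro: countable_finite)
qed

lemma config_borel: "sets (PiM UNIV (\<lambda>_. count_space UNIV)) = sets (borel :: 'd::finite config measure)"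
proof -
  have "sets (PiM UNIV (\<lambda>_::'d site. count_space (UNIV::bool set))) = sets (PiM UNIV (\<lambda>_::'d site. borel))"
    by (rule sets_PiM_cong) (simp_all add: sets_borel_eq_count_space)
  then show ?thesis by (simp add: sets_PiM_equal_borel)
qed


lemma continuous_measurable_config:
  fixes g :: "'d::finite config \<Rightarrow> real"
  assumes "continuous_on UNIV g"
  shows "g \<in> borel_measurable (bernoulli_measure lam \<mu>)"
  using borel_measurable_continuous_onI[OF assms]
  by (simp add: measurable_cong_sets[OF trans[OF sets_bernoulli_measure config_borel] refl])

lemma space_bernoulli_measure [simp]: "space (bernoulli_measure lam \<mu>) = UNIV"
  by (simp add: bernoulli_measure_def space_PiM PiE_def)

lemma measurable_bernoulliI:
  assumes "\<And>i. (\<lambda>x. F x i) \<in> measurable M (count_space UNIV)"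
  shows "F \<in> measurable M (bernoulli_measure lam \<mu> :: 'd::finite config measure)"
  unfolding measurable_cong_sets[OF refl sets_bernoulli_measure]
  by (rule measurable_PiM_single') (use assms in auto)

lemma measurable_site:
  "(\<lambda>x. x i) \<in> measurable (bernoulli_measure lam \<mu> :: 'd::finite config measure) (count_space UNIV)"
  unfolding measurable_cong_sets[OF sets_bernoulli_measure refl]
  by (rule measurable_component_singleton) simp

lemma measurable_fun_upd_config:
  "(\<lambda>x. x(i := b)) \<in> measurable (bernoulli_measure lam \<mu>) (bernoulli_measure lam \<mu> :: 'd::finite config measure)"
proof (rule measurable_bernoulliI)
  fix j
  show "(\<lambda>x. (x(i := b)) j) \<in> measurable (bernoulli_measure lam \<mu>) (count_space UNIV)"
    by (cases "j = i") (simp_all add: measurable_site)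
qed

text \<open>A transposition permutes identically distributed independent coordinates.\<close>

lemma bernoulli_swap:
  fixes g :: "'d::finite config \<Rightarrow> real"
  assumes g: "g \<in> borel_measurable (bernoulli_measure lam \<mu>)"
  shows "(\<integral>x. g (x \<circ> Transposition.transpose i i') \<partial>bernoulli_measure lam \<mu>) = (\<integral>x. g x \<partial>bernoulli_measure lam \<mu>)"
proof -
  let ?B = "bernoulli_measure lam \<mu> :: 'd config measure"
  have "distr ?B ?B (\<lambda>x. \<lambda>n\<in>UNIV. x (Transposition.transpose i i' n)) = ?B"
    unfolding bernoulli_measure_def
    by (rule distr_PiM_reindex) (auto intro: prob_space_measure_pmf)
  then have distr: "distr ?B ?B (\<lambda>x. x \<circ> Transposition.transpose i i') = ?B" by (simp add: comp_def restrict_def)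
  have "(\<lambda>x. x \<circ> Transposition.transpose i i') \<in> measurable ?B ?B"
    by (rule measurable_bernoulliI) (simp add: measurable_site)
  from integral_distr[OF this g] show ?thesis by (simp add: distr)
qed

text \<open>Overwriting site i by a fresh independent toss preserves the law; integrating out the
  toss gives the two terms. The factor \<open>lam + \<mu>\<close> clears denominators, leaving the
  birth and death rates as coefficients.\<close>

lemma bernoulli_resample:
  fixes g :: "'d::finite config \<Rightarrow> real"
  assumes g: "g \<in> borel_measurable (bernoulli_measure lam \<mu>)" and bounded: "\<And>x. \<bar>g x\<bar> \<le> c"
    and lam: "lam > 0" and \<mu>: "\<mu> > 0"
  shows "(lam + \<mu>) * (\<integral>x. g x \<partial>bernoulli_measure lam \<mu>) =
    lam * (\<integral>x. g (x(i := True)) \<partial>bernoulli_measure lam \<mu>)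
    + \<mu> * (\<integral>x. g (x(i := False)) \<partial>bernoulli_measure lam \<mu>)"
proof -
  let ?B = "bernoulli_measure lam \<mu> :: 'd config measure"
  let ?p = "lam / (lam + \<mu>)"
  let ?N = "measure_pmf (bernoulli_pmf ?p)"
  interpret B: prob_space ?B by (rule prob_space_bernoulli_measure)
  interpret N: prob_space ?N by (rule prob_space_measure_pmf)
  interpret NB: pair_prob_space ?N ?B ..
  have m: "(\<lambda>(b, x). x(i := b)) \<in> measurable (?N \<Otimes>\<^sub>M ?B) ?B"
  proof (rule measurable_bernoulliI)
    fix j
    have "(\<lambda>p. snd p j) \<in> measurable (?N \<Otimes>\<^sub>M ?B) (count_space UNIV)"
      by (rule measurable_compose[OF measurable_snd measurable_site])
    moreover have "fst \<in> measurable (?N \<Otimes>\<^sub>M ?B) (count_space UNIV)"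
      using measurable_fst[of ?N ?B] by (simp cong: measurable_cong_sets)
    ultimately show "(\<lambda>p. (case p of (b, x) \<Rightarrow> x(i := b)) j) \<in> measurable (?N \<Otimes>\<^sub>M ?B) (count_space UNIV)"
      by (cases "j = i") (auto simp: case_prod_unfold)
  qed
  \<comment> \<open>The coordinate i is adjoined to an index set that already contains it, so the
    old value is overwritten.\<close>
  have distr: "distr (?N \<Otimes>\<^sub>M ?B) ?B (\<lambda>(b, x). x(i := b)) = ?B"
    using distr_pair_PiM_eq_PiM[of UNIV "\<lambda>_. ?N" i]
    by (simp add: bernoulli_measure_def prob_space_measure_pmf)
  have p: "0 \<le> ?p" "?p \<le> 1" using lam \<mu> by (auto simp: field_simps)
  have gm: "(\<lambda>(b, x). g (x(i := b))) \<in> borel_measurable (?N \<Otimes>\<^sub>M ?B)"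
    using measurable_compose[OF m g] by (simp add: case_prod_unfold)
  have "(\<integral>x. g x \<partial>?B) = (\<integral>(b, x). g (x(i := b)) \<partial>(?N \<Otimes>\<^sub>M ?B))"
    using integral_distr[OF m g] unfolding distr by (simp add: case_prod_unfold)
  also have "\<dots> = (\<integral>b. \<integral>x. g (x(i := b)) \<partial>?B \<partial>?N)"
    using NB.integral_fst'[of "\<lambda>(b, x). g (x(i := b))"] gm bounded
    by (subst NB.integral_fst'[symmetric]) (auto intro!: NB.P.integrable_const_bound[of _ c])
  also have "\<dots> = ?p * (\<integral>x. g (x(i := True)) \<partial>?B) + (1 - ?p) * (\<integral>x. g (x(i := False)) \<partial>?B)"
    using p by (subst integral_bernoulli_pmf) (auto)
  also have "1 - ?p = \<mu> / (lam + \<mu>)" using lam \<mu> by (simp add: field_simps)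
  finally have "(\<integral>x. g x \<partial>?B) = lam / (lam + \<mu>) * (\<integral>x. g (x(i := True)) \<partial>?B)
      + \<mu> / (lam + \<mu>) * (\<integral>x. g (x(i := False)) \<partial>?B)" .
  moreover have "(lam + \<mu>) * (lam / (lam + \<mu>) * r + \<mu> / (lam + \<mu>) * s) = lam * r + \<mu> * s" for r s
    using lam \<mu> by (simp add: distrib_left)
  ultimately show ?thesis by (simp only:)
qed

text \<open>Fubini for counting measure times M. A bound c on all finite sums of absolute values,
  uniform in x, bounds the iterated integral by c times the finite total mass.\<close>

lemma integral_infsum_exchange:
  fixes f :: "'a \<Rightarrow> 'b \<Rightarrow> real"
  assumes M: "finite_measure M" and A: "countable A"
    and meas: "\<And>a. a \<in> A \<Longrightarrow> f a \<in> borel_measurable M"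
    and bounded: "\<And>x F. x \<in> space M \<Longrightarrow> finite F \<Longrightarrow> F \<subseteq> A \<Longrightarrow> (\<Sum>a\<in>F. \<bar>f a x\<bar>) \<le> c"
  shows "\<And>x. x \<in> space M \<Longrightarrow> (\<lambda>a. f a x) summable_on A"
    and "integrable M (\<lambda>x. \<Sum>\<^sub>\<infinity>a\<in>A. f a x)"
    and "(\<lambda>a. \<integral>x. f a x \<partial>M) summable_on A"
    and "(\<integral>x. (\<Sum>\<^sub>\<infinity>a\<in>A. f a x) \<partial>M) = (\<Sum>\<^sub>\<infinity>a\<in>A. \<integral>x. f a x \<partial>M)"
proof -
  interpret finite_measure M by (rule M)
  interpret A: sigma_finite_measure "count_space A" by (rule sigma_finite_measure_count_space_countable[OF A])
  interpret pair_sigma_finite "count_space A" M ..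
  have abs: "Infinite_Set_Sum.abs_summable_on (\<lambda>a. f a x) A" if "x \<in> space M" for x
    using bounded[OF that] by (intro abs_summable_finite_sumsI[of _ _ c]) auto
  have infsum: "(\<Sum>\<^sub>\<infinity>a\<in>A. f a x) = (\<integral>a. f a x \<partial>count_space A)" if "x \<in> space M" for x
    using infsetsum_infsum[OF abs[OF that]] by (simp add: infsetsum_def)
  show "\<And>x. x \<in> space M \<Longrightarrow> (\<lambda>a. f a x) summable_on A"
    using abs by (simp add: abs_summable_equivalent[symmetric] abs_summable_summable)
  have fm: "(\<lambda>(a, x). f a x) \<in> borel_measurable (count_space A \<Otimes>\<^sub>M M)"
    by (rule measurable_pair_measure_countable1[OF A]) (simp add: meas)
  have "(\<integral>\<^sup>+x. \<integral>\<^sup>+a. ennreal (norm (f a x)) \<partial>count_space A \<partial>M) \<le> (\<integral>\<^sup>+x. ennreal c \<partial>M)"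
  proof (rule nn_integral_mono)
    fix x assume x: "x \<in> space M"
    have int: "integrable (count_space A) (\<lambda>a. norm (f a x))"
      using abs[OF x] by (simp add: abs_summable_on_def)
    then have s: "Infinite_Set_Sum.abs_summable_on (\<lambda>a. norm (f a x)) A" by (simp add: abs_summable_on_def)
    have "(\<integral>a. norm (f a x) \<partial>count_space A) = (\<Sum>\<^sub>\<infinity>a\<in>A. norm (f a x))"
      using infsetsum_infsum[OF s] by (simp add: infsetsum_def)
    also have "\<dots> \<le> c"
      using s abs[OF x] bounded[OF x]
      by (intro infsum_le_finite_sums) (auto simp: abs_summable_equivalent[symmetric])
    finally show "(\<integral>\<^sup>+a. ennreal (norm (f a x)) \<partial>count_space A) \<le> ennreal c"
      using int by (subst nn_integral_eq_integral) (auto intro: ennreal_leI)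
  qed
  also have "\<dots> < \<infinity>" by (simp add: ennreal_mult_less_top emeasure_eq_measure)
  finally have "(\<integral>\<^sup>+p. ennreal (norm (case p of (a, x) \<Rightarrow> f a x)) \<partial>(count_space A \<Otimes>\<^sub>M M)) < \<infinity>"
    using fm by (subst nn_integral_snd[symmetric]) (auto simp: case_prod_unfold)
  then have int: "integrable (count_space A \<Otimes>\<^sub>M M) (\<lambda>(a, x). f a x)"
    using fm by (simp add: integrable_iff_bounded)
  have int_a: "integrable (count_space A) (\<lambda>a. \<integral>x. f a x \<partial>M)"
    using integrable_fst'[OF int] by simp
  then have s: "Infinite_Set_Sum.abs_summable_on (\<lambda>a. \<integral>x. f a x \<partial>M) A" by (simp add: abs_summable_on_def)
  then show "(\<lambda>a. \<integral>x. f a x \<partial>M) summable_on A"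
    by (simp only: abs_summable_equivalent[symmetric] abs_summable_summable)
  have "integrable M (\<lambda>x. \<integral>a. f a x \<partial>count_space A)"
    using integrable_snd[OF int] by simp
  then show "integrable M (\<lambda>x. \<Sum>\<^sub>\<infinity>a\<in>A. f a x)"
    by (simp add: infsum cong: Bochner_Integration.integrable_cong)
  have "(\<integral>x. (\<Sum>\<^sub>\<infinity>a\<in>A. f a x) \<partial>M) = (\<integral>x. (\<integral>a. f a x \<partial>count_space A) \<partial>M)"
    by (intro Bochner_Integration.integral_cong infsum refl)
  also have "\<dots> = (\<integral>a. (\<integral>x. f a x \<partial>M) \<partial>count_space A)"
    by (rule Fubini_integral[OF int])
  also have "\<dots> = (\<Sum>\<^sub>\<infinity>a\<in>A. \<integral>x. f a x \<partial>M)"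
    using infsetsum_infsum[OF s] by (simp add: infsetsum_def)
  finally show "(\<integral>x. (\<Sum>\<^sub>\<infinity>a\<in>A. f a x) \<partial>M) = (\<Sum>\<^sub>\<infinity>a\<in>A. \<integral>x. f a x \<partial>M)" .
qed


section \<open>Stationarity of the particle dynamics\<close>

lemma sum_le_infsum_ennreal:
  fixes f :: "'a \<Rightarrow> real"
  assumes f: "\<And>i. f i \<ge> 0" and le: "(\<Sum>\<^sub>\<infinity>i. ennreal (f i)) \<le> ennreal c" and c: "c \<ge> 0" and F: "finite F"
  shows "sum f F \<le> c"
proof -
  have "ennreal (sum f F) = (\<Sum>\<^sub>\<infinity>i\<in>F. ennreal (f i))" using f F by (simp add: sum_ennreal)
  also have "\<dots> \<le> (\<Sum>\<^sub>\<infinity>i. ennreal (f i))"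
    by (intro infsum_mono_neutral nonneg_summable_on_complete) auto
  finally show ?thesis using le c by (metis ennreal_le_iff order_trans)
qed

lemma occ_nonneg [simp]: "0 \<le> occ x i" and occ_le_1 [simp]: "occ x i \<le> 1"
  by (simp_all add: occ_def)

text \<open>The value of the seminorm serves as c. Finite sums of reals are the form in which
  \<open>integral_infsum_exchange\<close> takes its bound.\<close>

lemma C_L_finite_sums:
  assumes g: "g \<in> C_L w" and w: "\<And>i i'. w i i' \<ge> 0"
  obtains c where
    "\<And>x F. finite F \<Longrightarrow> (\<Sum>i\<in>F. occ x i * \<bar>g (death i x) - g x\<bar>) \<le> c"
    "\<And>x F. finite F \<Longrightarrow> (\<Sum>i\<in>F. (1 - occ x i) * \<bar>g (birth i x) - g x\<bar>) \<le> c"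
    "\<And>x F. finite F \<Longrightarrow> (\<Sum>(i, i')\<in>F. w i i' * (occ x i * (1 - occ x i') * \<bar>g (jump i i' x) - g x\<bar>)) \<le> c"
proof -
  define c where "c = enn2real (lip_seminorm w g)"
  have "lip_seminorm w g = ennreal c" using g by (simp add: C_L_def c_def less_top)
  then have le: "(\<Sum>\<^sub>\<infinity>i. ennreal (occ x i * \<bar>g (death i x) - g x\<bar>))
     + (\<Sum>\<^sub>\<infinity>i. ennreal ((1 - occ x i) * \<bar>g (birth i x) - g x\<bar>))
     + (\<Sum>\<^sub>\<infinity>(i, i'). ennreal (w i i' * (occ x i * (1 - occ x i') * \<bar>g (jump i i' x) - g x\<bar>))) \<le> ennreal c" for x
    unfolding lip_seminorm_def by (metis (no_types, lifting) SUP_upper UNIV_I)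
  have parts: "a \<le> c" "b \<le> c" "d \<le> c" if "a + b + d \<le> c" for a b d c :: ennreal
    using that by (meson add_increasing2 add_increasing order_refl order_trans zero_le)+
  show ?thesis
  proof (rule that)
    fix x
    show "finite F \<Longrightarrow> (\<Sum>i\<in>F. occ x i * \<bar>g (death i x) - g x\<bar>) \<le> c" for F
      by (rule sum_le_infsum_ennreal[OF _ parts(1)[OF le[of x]]]) (simp_all add: c_def)
    show "finite F \<Longrightarrow> (\<Sum>i\<in>F. (1 - occ x i) * \<bar>g (birth i x) - g x\<bar>) \<le> c" for F
      by (rule sum_le_infsum_ennreal[OF _ parts(2)[OF le[of x]]]) (simp_all add: c_def)
    show "finite F \<Longrightarrow> (\<Sum>(i, i')\<in>F. w i i' * (occ x i * (1 - occ x i') * \<bar>g (jump i i' x) - g x\<bar>)) \<le> c" for F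
      by (rule sum_le_infsum_ennreal)
        (use parts(3)[OF le[of x]] w in \<open>auto simp: c_def case_prod_unfold\<close>)
  qed
qed

lemma compact_config: "compact (UNIV :: 'd::finite config set)"
proof -
  have "compact_space (product_topology (\<lambda>_::'d site. euclidean :: bool topology) UNIV)"
    unfolding compact_space_product_topology
    by (auto simp: compact_space_def finite_imp_compact)
  then show ?thesis
    by (simp add: euclidean_product_topology compact_space_def)
qed

lemma continuous_config_bounded:
  fixes g :: "'d::finite config \<Rightarrow> real"
  assumes "continuous_on UNIV g"
  obtains c where "\<And>x. \<bar>g x\<bar> \<le> c"
proof -
  have "compact (range g)" using assms compact_config by (rule compact_continuous_image)
  then have "bounded (range g)" by (rule compact_imp_bounded)
  then show ?thesis using that by (auto simp: bounded_iff)
qed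

text \<open>Exchanging the two components permutes the off-diagonal pairs, so the sum equals its own
  negative.\<close>

lemma infsum_antisymmetric:
  fixes K :: "'a \<times> 'a \<Rightarrow> real"
  assumes "\<And>i i'. i \<noteq> i' \<Longrightarrow> K (i', i) = - K (i, i')"
  shows "(\<Sum>\<^sub>\<infinity>p\<in>{(i, i'). i \<noteq> i'}. K p) = 0"
proof -
  let ?D = "{(i, i'). i \<noteq> (i' :: 'a)}"
  have "infsum K ?D = (\<Sum>\<^sub>\<infinity>p\<in>?D. K (prod.swap p))"
    by (rule infsum_reindex_bij_witness[where i = prod.swap and j = prod.swap]) auto
  also have "\<dots> = (\<Sum>\<^sub>\<infinity>p\<in>?D. - K p)"
  proof (rule infsum_cong)
    fix p assume "p \<in> ?D"
    then show "K (prod.swap p) = - K p" using assms[of "fst p" "snd p"] by (cases p) simp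
  qed
  finally show ?thesis by (simp add: infsum_uminus)
qed

text \<open>A jump between z and another site and its reverse lie in different sums of
  \<open>op_L\<close>: jumps out of z belong to the first, jumps into z to the second. The sums must
  therefore be integrated and merged before antisymmetry can be used.\<close>

lemma op_L_stationary:
  fixes \<beta> w :: "'d::finite site \<Rightarrow> 'd site \<Rightarrow> real"
  assumes lam: "lam > 0" and \<mu>: "\<mu> > 0"
    and \<beta>_sym: "\<And>i i'. \<beta> i i' = \<beta> i' i" and \<beta>_nonneg: "\<And>i i'. \<beta> i i' \<ge> 0"
    and \<beta>_sup: "(SUP i. \<Sum>\<^sub>\<infinity>i'. ennreal (\<beta> i i')) < \<infinity>"
    and w: "w = (\<lambda>_ _. 1) \<or> w = \<beta>" and g: "g \<in> C_L w"
  shows "integrable (bernoulli_measure lam \<mu>) (\<lambda>x. exp (\<phi> * occ x z) * op_L \<phi> lam \<mu> \<beta> z g x)"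
    and "(\<integral>x. exp (\<phi> * occ x z) * op_L \<phi> lam \<mu> \<beta> z g x \<partial>bernoulli_measure lam \<mu>) = 0"
proof -
  let ?B = "bernoulli_measure lam \<mu> :: 'd config measure"
  interpret B: prob_space ?B by (rule prob_space_bernoulli_measure)
  have g_cont: "continuous_on UNIV g" using g by (simp add: C_L_def)
  define bs where "bs = enn2real (SUP i. \<Sum>\<^sub>\<infinity>i'. ennreal (\<beta> i i'))"
  have bs: "\<beta> i i' \<le> bs" "0 \<le> bs" for i i'
  proof -
    have "(SUP i. \<Sum>\<^sub>\<infinity>i'. ennreal (\<beta> i i')) = ennreal bs" using \<beta>_sup by (simp add: bs_def less_top)
    then have "(\<Sum>\<^sub>\<infinity>i'. ennreal (\<beta> i i')) \<le> ennreal bs" by (metis (no_types, lifting) SUP_upper UNIV_I)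
    then show "\<beta> i i' \<le> bs"
      using sum_le_infsum_ennreal[of "\<beta> i" bs "{i'}"] \<beta>_nonneg by (auto simp: bs_def)
    show "0 \<le> bs" by (simp add: bs_def)
  qed
  have w0: "w i i' \<ge> 0" for i i' using w \<beta>_nonneg by auto
  obtain c where
    c_death: "\<And>x F. finite F \<Longrightarrow> (\<Sum>i\<in>F. occ x i * \<bar>g (death i x) - g x\<bar>) \<le> c"
    and c_birth: "\<And>x F. finite F \<Longrightarrow> (\<Sum>i\<in>F. (1 - occ x i) * \<bar>g (birth i x) - g x\<bar>) \<le> c"
    and c_jump: "\<And>x F. finite F \<Longrightarrow>
      (\<Sum>(i, i')\<in>F. w i i' * (occ x i * (1 - occ x i') * \<bar>g (jump i i' x) - g x\<bar>)) \<le> c"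
    by (rule C_L_finite_sums[OF g w0]) (rule that; assumption)
  have c_jump_\<beta>: "(\<Sum>(i, i')\<in>F. \<beta> i i' * (occ x i * (1 - occ x i') * \<bar>g (jump i i' x) - g x\<bar>)) \<le> (bs + 1) * c"
    if F: "finite F" for x F
  proof -
    \<comment> \<open>One constant for both weights: if w = 1 then \<beta> \<le> bs, and if w =
      \<beta> then bs + 1 \<ge> 1. Either way the seminorm controls the jumps with their true
      rates.\<close>
    have "\<beta> i i' \<le> (bs + 1) * w i i'" for i i'
      using w bs(1)[of i i'] \<beta>_nonneg[of i i'] by (auto simp: distrib_right)
    then have "(\<Sum>(i, i')\<in>F. \<beta> i i' * (occ x i * (1 - occ x i') * \<bar>g (jump i i' x) - g x\<bar>))
      \<le> (\<Sum>(i, i')\<in>F. (bs + 1) * w i i' * (occ x i * (1 - occ x i') * \<bar>g (jump i i' x) - g x\<bar>))"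
      by (intro sum_mono) (auto intro!: mult_right_mono)
    also have "\<dots> = (bs + 1) * (\<Sum>(i, i')\<in>F. w i i' * (occ x i * (1 - occ x i') * \<bar>g (jump i i' x) - g x\<bar>))"
      by (simp add: sum_distrib_left case_prod_unfold mult.assoc)
    also have "\<dots> \<le> (bs + 1) * c" using c_jump[OF F] bs by (intro mult_left_mono) auto
    finally show ?thesis .
  qed
  \<comment> \<open>\<open>W\<close> is the density, and \<open>V i\<close> the factor that the
    dynamics attaches to an arrival at i, by jump or by birth. With them z is treated like any other
    site: \<open>k p\<close> is the weighted contribution of the jump along p, \<open>b i\<close>
    that of births and deaths at i.\<close>
  define W where "W x = exp (\<phi> * occ x z)" for x
  define V where "V i = (if i = z then exp \<phi> else 1)" for i
  define k where "k p x = W x * (occ x (fst p) * (1 - occ x (snd p)) * \<beta> (fst p) (snd p) * V (snd p)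
      * (g (jump (fst p) (snd p) x) - g x))" for p x
  define b where "b i x = W x * (lam * V i * (1 - occ x i) * (g (birth i x) - g x)
      + \<mu> * occ x i * (g (death i x) - g x))" for i x
  define K where "K p = (\<integral>x. k p x \<partial>?B)" for p
  let ?e = "exp \<bar>\<phi>\<bar>"
  have W: "0 \<le> W x" "W x \<le> ?e" for x by (auto simp: W_def occ_def)
  have V: "0 \<le> V i" "V i \<le> ?e" for i by (auto simp: V_def)

  have k_le: "\<bar>k (i, i') x\<bar> \<le> ?e * ?e * (\<beta> i i' * (occ x i * (1 - occ x i') * \<bar>g (jump i i' x) - g x\<bar>))" for i i' x
  proof -
    let ?r = "\<beta> i i' * (occ x i * (1 - occ x i') * \<bar>g (jump i i' x) - g x\<bar>)"
    have r: "0 \<le> ?r" using \<beta>_nonneg by auto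
    have "\<bar>k (i, i') x\<bar> = (W x * V i') * ?r"
      using W V \<beta>_nonneg by (simp add: k_def abs_mult)
    also have "\<dots> \<le> (?e * ?e) * ?r" using W V by (intro mult_right_mono mult_mono r) auto
    finally show ?thesis .
  qed
  have k_sum: "(\<Sum>p\<in>F. \<bar>k p x\<bar>) \<le> ?e * ?e * ((bs + 1) * c)" if F: "finite F" for x F
  proof -
    have "(\<Sum>p\<in>F. \<bar>k p x\<bar>) \<le> (\<Sum>(i, i')\<in>F. ?e * ?e * (\<beta> i i' * (occ x i * (1 - occ x i') * \<bar>g (jump i i' x) - g x\<bar>)))"
      using k_le by (intro sum_mono) auto
    also have "\<dots> = ?e * ?e * (\<Sum>(i, i')\<in>F. \<beta> i i' * (occ x i * (1 - occ x i') * \<bar>g (jump i i' x) - g x\<bar>))"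
      by (simp add: sum_distrib_left case_prod_unfold)
    also have "\<dots> \<le> ?e * ?e * ((bs + 1) * c)" using c_jump_\<beta>[OF F] by (intro mult_left_mono) auto
    finally show ?thesis .
  qed
  have b_le: "\<bar>b i x\<bar> \<le> ?e * (lam * ?e * ((1 - occ x i) * \<bar>g (birth i x) - g x\<bar>)
      + \<mu> * (occ x i * \<bar>g (death i x) - g x\<bar>))" for i x
  proof -
    have "\<bar>lam * V i * (1 - occ x i) * (g (birth i x) - g x)\<bar> \<le> lam * ?e * ((1 - occ x i) * \<bar>g (birth i x) - g x\<bar>)"
      using lam V by (auto simp: abs_mult mult.assoc intro!: mult_left_mono mult_right_mono)
    moreover have "\<bar>\<mu> * occ x i * (g (death i x) - g x)\<bar> = \<mu> * (occ x i * \<bar>g (death i x) - g x\<bar>)"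
      using \<mu> by (simp add: abs_mult)
    ultimately have "\<bar>lam * V i * (1 - occ x i) * (g (birth i x) - g x) + \<mu> * occ x i * (g (death i x) - g x)\<bar>
      \<le> lam * ?e * ((1 - occ x i) * \<bar>g (birth i x) - g x\<bar>) + \<mu> * (occ x i * \<bar>g (death i x) - g x\<bar>)"
      by linarith
    then show ?thesis
      unfolding b_def abs_mult using W[of x] by (intro mult_mono) auto
  qed
  have b_sum: "(\<Sum>i\<in>F. \<bar>b i x\<bar>) \<le> ?e * (lam * ?e * c + \<mu> * c)" if F: "finite F" for x F
  proof -
    have "(\<Sum>i\<in>F. \<bar>b i x\<bar>) \<le> (\<Sum>i\<in>F. ?e * (lam * ?e * ((1 - occ x i) * \<bar>g (birth i x) - g x\<bar>)
        + \<mu> * (occ x i * \<bar>g (death i x) - g x\<bar>)))"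
      by (intro sum_mono b_le)
    also have "\<dots> = ?e * (lam * ?e * (\<Sum>i\<in>F. (1 - occ x i) * \<bar>g (birth i x) - g x\<bar>)
        + \<mu> * (\<Sum>i\<in>F. occ x i * \<bar>g (death i x) - g x\<bar>))"
      by (simp add: sum.distrib flip: sum_distrib_left)
    also have "\<dots> \<le> ?e * (lam * ?e * c + \<mu> * c)"
      using lam \<mu> c_birth[OF F] c_death[OF F] by (intro mult_left_mono add_mono) auto
    finally show ?thesis .
  qed

  have gm: "g \<in> borel_measurable ?B" by (rule continuous_measurable_config[OF g_cont])
  have gm_upd: "(\<lambda>x. g (x(i := u))) \<in> borel_measurable ?B" for i u
    by (rule measurable_compose[OF measurable_fun_upd_config gm])
  have gm_jump: "(\<lambda>x. g (jump i i' x)) \<in> borel_measurable ?B" for i i'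
    unfolding jump_def by (rule measurable_compose[OF measurable_fun_upd_config gm_upd])
  note [measurable] = gm gm_jump measurable_occ
  note gm_birth = gm_upd[of _ True, folded birth_def] and gm_death = gm_upd[of _ False, folded death_def]
  note [measurable] = gm_birth gm_death
  have Wm[measurable]: "W \<in> borel_measurable ?B" unfolding W_def by measurable
  have km: "k p \<in> borel_measurable ?B" for p unfolding k_def by measurable
  have bm: "b i \<in> borel_measurable ?B" for i unfolding b_def by measurable
  have b_int: "integrable ?B (b i)" for i
    using b_sum[of "{i}"] bm by (intro B.integrable_const_bound) auto
  have k_int: "integrable ?B (k p)" for p
    using k_sum[of "{p}"] km by (intro B.integrable_const_bound) auto

  have b_0: "(\<integral>x. b i x \<partial>?B) = 0" for i
  proof -
    \<comment> \<open>Detailed balance at a single site: filling i multiplies the density by exactly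
      the factor in the birth rate, so birth from the empty state offsets death from the occupied
      one.\<close>
    have "W (x(i := True)) = V i * W (x(i := False))" for x
      by (auto simp: W_def V_def occ_def)
    then have "lam * b i (x(i := True)) = - (\<mu> * b i (x(i := False)))" for x
      by (simp add: b_def occ_def birth_def death_def algebra_simps)
    then have "lam * (\<integral>x. b i (x(i := True)) \<partial>?B) = - (\<mu> * (\<integral>x. b i (x(i := False)) \<partial>?B))"
      by (simp flip: integral_mult_right_zero Bochner_Integration.integral_minus)
    moreover have "(lam + \<mu>) * (\<integral>x. b i x \<partial>?B) =
        lam * (\<integral>x. b i (x(i := True)) \<partial>?B) + \<mu> * (\<integral>x. b i (x(i := False)) \<partial>?B)"
      using b_sum[of "{i}"] by (intro bernoulli_resample[OF bm _ lam \<mu>]) auto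
    ultimately show ?thesis using lam \<mu> by simp
  qed

  have K_antisym: "K (i', i) = - K (i, i')" if ne: "i \<noteq> i'" for i i'
  proof -
    let ?t = "Transposition.transpose i i'"
    \<comment> \<open>Only configurations with i occupied and i' empty contribute, and on these the
      transposition acts as the jump from i to i'. Otherwise an occupation factor vanishes on both
      sides.\<close>
    have "k (i', i) (x \<circ> ?t) = - k (i, i') x" for x
    proof (cases "x i \<and> \<not> x i'")
      case True
      then have 1: "x \<circ> ?t = jump i i' x"
        using ne by (auto simp: jump_def fun_eq_iff Transposition.transpose_def)
      have 2: "jump i' i (jump i i' x) = x"
        using True ne by (auto simp: jump_def fun_eq_iff)
      \<comment> \<open>Detailed balance for exchanges: the density changes precisely when z is one
        of the two sites, and the arrival factors compensate for it.\<close>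
      have 3: "W (jump i i' x) * V i = W x * V i'"
        using True ne by (auto simp: W_def V_def jump_def occ_def)
      have 4: "occ (jump i i' x) i' = 1" "occ (jump i i' x) i = 0" "occ x i = 1" "occ x i' = 0"
        using True ne by (auto simp: jump_def occ_def)
      have "k (i', i) (x \<circ> ?t) = (W (jump i i' x) * V i) * \<beta> i i' * (g x - g (jump i i' x))"
        unfolding 1 by (simp add: k_def 2 4 \<beta>_sym[of i' i])
      also have "\<dots> = - k (i, i') x"
        unfolding 3 by (simp add: k_def 4 algebra_simps)
      finally show ?thesis .
    next
      case False
      then show ?thesis by (auto simp: k_def occ_def)
    qed
    then have "(\<integral>x. k (i', i) x \<partial>?B) = (\<integral>x. - k (i, i') x \<partial>?B)"
      using bernoulli_swap[OF km, of "(i', i)" i i'] by simp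
    then show ?thesis by (simp add: K_def)
  qed

  let ?P = "{(i, i'). i \<noteq> i' \<and> i' \<noteq> z}"
  \<comment> \<open>The grouping follows \<open>op_L\<close>, where jumps into z share one series
    with births and deaths; they can be separated after integration, when each \<open>b i\<close>
    contributes 0.\<close>
  have split: "exp (\<phi> * occ x z) * op_L \<phi> lam \<mu> \<beta> z g x
    = (\<Sum>\<^sub>\<infinity>p\<in>?P. k p x) + (\<Sum>\<^sub>\<infinity>i\<in>-{z}. k (i, z) x + b i x) + b z x" for x
  proof -
    have 1: "(\<Sum>\<^sub>\<infinity>p\<in>?P. k p x) = W x * (\<Sum>\<^sub>\<infinity>(i, i')\<in>?P.
        occ x i * (1 - occ x i') * \<beta> i i' * (g (jump i i' x) - g x))"
      unfolding infsum_cmult_right'[symmetric] by (rule infsum_cong) (auto simp: k_def V_def)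
    have 2: "(\<Sum>\<^sub>\<infinity>i\<in>-{z}. k (i, z) x + b i x) = W x * (\<Sum>\<^sub>\<infinity>i\<in>-{z}.
        occ x i * (1 - occ x z) * \<beta> i z * exp \<phi> * (g (jump i z x) - g x)
        + lam * (1 - occ x i) * (g (birth i x) - g x)
        + \<mu> * occ x i * (g (death i x) - g x))"
      unfolding infsum_cmult_right'[symmetric]
      by (rule infsum_cong) (auto simp: k_def b_def V_def algebra_simps)
    have 3: "b z x = W x * (lam * exp \<phi> * (1 - occ x z) * (g (birth z x) - g x)
        + \<mu> * occ x z * (g (death z x) - g x))"
      by (simp add: b_def V_def)
    show ?thesis
      by (simp only: 1 2 3 op_L_def W_def[symmetric] distrib_left add.assoc)
  qed
  have kb_sum: "(\<Sum>i\<in>F. \<bar>k (i, z) x + b i x\<bar>) \<le> ?e * ?e * ((bs + 1) * c) + ?e * (lam * ?e * c + \<mu> * c)"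
    if F: "finite F" for x F
  proof -
    have "(\<Sum>i\<in>F. \<bar>k (i, z) x + b i x\<bar>) \<le> (\<Sum>i\<in>F. \<bar>k (i, z) x\<bar>) + (\<Sum>i\<in>F. \<bar>b i x\<bar>)"
      unfolding sum.distrib[symmetric] by (intro sum_mono abs_triangle_ineq)
    also have "(\<Sum>i\<in>F. \<bar>k (i, z) x\<bar>) = (\<Sum>p\<in>(\<lambda>i. (i, z)) ` F. \<bar>k p x\<bar>)"
      by (simp add: sum.reindex inj_on_def)
    finally show ?thesis using k_sum[of "(\<lambda>i. (i, z)) ` F" x] b_sum[OF F, of x] F by force
  qed
  have kbm: "(\<lambda>x. k (i, z) x + b i x) \<in> borel_measurable ?B" for i using km bm by simp
  note exch_k = integral_infsum_exchange[OF B.finite_measure_axioms countableI_type km k_sum]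
  note exch_kb = integral_infsum_exchange[OF B.finite_measure_axioms countableI_type kbm kb_sum]
  have K_sum: "K summable_on A" for A unfolding K_def[abs_def] by (rule exch_k(3))
  show "integrable ?B (\<lambda>x. exp (\<phi> * occ x z) * op_L \<phi> lam \<mu> \<beta> z g x)"
    unfolding split by (intro Bochner_Integration.integrable_add exch_k(2) exch_kb(2) b_int)
  have "(\<integral>x. exp (\<phi> * occ x z) * op_L \<phi> lam \<mu> \<beta> z g x \<partial>?B)
      = (\<integral>x. (\<Sum>\<^sub>\<infinity>p\<in>?P. k p x) \<partial>?B) + (\<integral>x. (\<Sum>\<^sub>\<infinity>i\<in>-{z}. k (i, z) x + b i x) \<partial>?B) + (\<integral>x. b z x \<partial>?B)"
    unfolding split
    by (simp only: Bochner_Integration.integral_add Bochner_Integration.integrable_add exch_k(2) exch_kb(2) b_int)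
  also have "(\<integral>x. (\<Sum>\<^sub>\<infinity>p\<in>?P. k p x) \<partial>?B) = infsum K ?P"
    unfolding K_def[abs_def] by (rule exch_k(4))
  also have "(\<integral>x. (\<Sum>\<^sub>\<infinity>i\<in>-{z}. k (i, z) x + b i x) \<partial>?B) = (\<Sum>\<^sub>\<infinity>i\<in>-{z}. K (i, z))"
    by (simp only: exch_kb(4) Bochner_Integration.integral_add k_int b_int b_0 K_def add_0_right)
  also have "\<dots> = infsum K ((\<lambda>i. (i, z)) ` (- {z}))"
    by (subst infsum_reindex) (simp_all add: inj_on_def comp_def)
  \<comment> \<open>Adjoining the pairs that end at z completes the index set to all off-diagonal
    pairs, which is symmetric.\<close>
  also have "infsum K ?P + infsum K ((\<lambda>i. (i, z)) ` (- {z})) = infsum K (?P \<union> (\<lambda>i. (i, z)) ` (- {z}))"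
    by (intro infsum_Un_disjoint[symmetric] K_sum) auto
  also have "?P \<union> (\<lambda>i. (i, z)) ` (- {z}) = {(i, i'). i \<noteq> i'}" by auto
  also have "infsum K {(i, i'). i \<noteq> i'} = 0" by (intro infsum_antisymmetric K_antisym)
  finally show "(\<integral>x. exp (\<phi> * occ x z) * op_L \<phi> lam \<mu> \<beta> z g x \<partial>?B) = 0"
    by (simp add: b_0)
qed


section \<open>The measure kappa\<close>

lemma space_state_space [simp]: "space (state_space T) = T \<times> UNIV"
  by (simp add: state_space_def space_pair_measure space_PiM PiE_def)

lemma continuous_on_section:
  assumes "continuous_on (T \<times> UNIV) f" "z \<in> T"
  shows "continuous_on UNIV (\<lambda>x. f (z, x))"
  by (rule continuous_on_compose2[OF assms(1)]) (use assms(2) in \<open>auto intro!: continuous_intros\<close>)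

lemma continuous_bounded_state:
  fixes f :: "'d::finite site \<times> 'd config \<Rightarrow> real"
  assumes T: "finite T" and f: "continuous_on (T \<times> UNIV) f"
  obtains c where "\<And>\<xi>. \<xi> \<in> T \<times> UNIV \<Longrightarrow> \<bar>f \<xi>\<bar> \<le> c" "0 \<le> c"
proof -
  have "compact (f ` (T \<times> UNIV))"
    by (intro compact_continuous_image f compact_Times finite_imp_compact T compact_config)
  then have "bounded (f ` (T \<times> UNIV))" by (rule compact_imp_bounded)
  then obtain c where "\<And>\<xi>. \<xi> \<in> T \<times> UNIV \<Longrightarrow> \<bar>f \<xi>\<bar> \<le> c" by (auto simp: bounded_iff)
  then show ?thesis using that[of "max c 0"] by (meson max.cobounded2 max.coboundedI1)
qed

lemma continuous_measurable_state:
  fixes f :: "'d::finite site \<times> 'd config \<Rightarrow> real"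
  assumes T: "finite T" and f: "continuous_on (T \<times> UNIV) f"
  shows "f \<in> borel_measurable (state_space T)"
  unfolding state_space_def
proof (rule measurable_pair_measure_countable1)
  show "countable T" using T by (rule countable_finite)
  fix z assume "z \<in> T"
  from continuous_measurable_config[OF continuous_on_section[OF f this]]
  show "(\<lambda>x. f (z, x)) \<in> borel_measurable (PiM UNIV (\<lambda>_. count_space UNIV))"
    unfolding measurable_cong_sets[OF sets_bernoulli_measure refl] .
qed

lemma continuous_on_discrete_comp:
  fixes f :: "'a::topological_space \<Rightarrow> 'b::discrete_topology"
  assumes "continuous_on S f"
  shows "continuous_on S (\<lambda>x. g (f x))"
  by (rule continuous_on_compose2[OF Topological_Spaces.continuous_on_discrete[of UNIV g] assms]) simp

text \<open>The sets with continuous indicator are the clopen ones.\<close>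

lemma sets_state_space_clopen:
  fixes T :: "'d::finite site set"
  assumes T: "finite T"
  shows "sets (state_space T) = sigma_sets (T \<times> UNIV)
    {B. B \<subseteq> T \<times> UNIV \<and> continuous_on (T \<times> UNIV) (indicator B :: _ \<Rightarrow> real)}"
    (is "_ = sigma_sets ?S ?G")
proof
  have G: "?G \<subseteq> Pow ?S" by auto
  let ?M = "sigma ?S ?G"
  have sp: "space ?M = ?S" using G by (rule space_measure_of)
  have B_in: "B \<in> sets ?M" if "B \<in> ?G" for B using that G by (simp add: sets_measure_of)
  have fst_in: "fst -` {z} \<inter> ?S \<in> ?G" for z
  proof -
    \<comment> \<open>A site is isolated by its finitely many integer coordinates, so its indicator
      is a finite product of functions that factor through a discrete space.\<close>
    have "continuous_on ?S (\<lambda>\<xi>. \<Prod>j\<in>UNIV. of_bool (fst \<xi> $ j = z $ j) :: real)"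
    proof (intro continuous_on_prod)
      fix j
      show "continuous_on ?S (\<lambda>\<xi>. of_bool (fst \<xi> $ j = z $ j) :: real)"
        by (intro continuous_on_discrete_comp[where g = "\<lambda>y. of_bool (y = z $ j)"] continuous_intros)
    qed
    also have "(\<lambda>\<xi>. \<Prod>j\<in>UNIV. of_bool (fst \<xi> $ j = z $ j) :: real) = (\<lambda>\<xi>. of_bool (fst \<xi> = z))"
      by (auto simp: fun_eq_iff vec_eq_iff)
    finally have "continuous_on ?S (\<lambda>\<xi>. of_bool (fst \<xi> = z) :: real)" .
    then have "continuous_on ?S (indicator (fst -` {z} \<inter> ?S) :: _ \<Rightarrow> real)"
      by (rule continuous_on_eq) (auto simp: indicator_def)
    then show ?thesis by auto
  qed
  have snd_in: "(\<lambda>\<xi>. snd \<xi> i) -` {b} \<inter> ?S \<in> ?G" for i b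
  proof -
    have "continuous_on ?S (\<lambda>\<xi>. of_bool (snd \<xi> i = b) :: real)"
      by (intro continuous_on_discrete_comp[where g = "\<lambda>y. of_bool (y = b)"]
          continuous_on_product_then_coordinatewise[OF continuous_on_snd[OF continuous_on_id]])
    then have "continuous_on ?S (indicator ((\<lambda>\<xi>. snd \<xi> i) -` {b} \<inter> ?S) :: _ \<Rightarrow> real)"
      by (rule continuous_on_eq) (auto simp: indicator_def)
    then show ?thesis by auto
  qed
  have "fst \<in> measurable ?M (count_space T)"
    unfolding measurable_count_space_eq2[OF T] sp using B_in[OF fst_in] by auto
  moreover have "snd \<in> measurable ?M (PiM UNIV (\<lambda>_. count_space UNIV))"
  proof (rule measurable_PiM_single')
    show "(\<lambda>\<xi>. snd \<xi> i) \<in> measurable ?M (count_space UNIV)" for i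
      unfolding measurable_count_space_eq2[OF finite] sp using B_in[OF snd_in] by auto
  qed auto
  \<comment> \<open>Measurability of the identity from the clopen \<sigma>-algebra is the inclusion
    of \<sigma>-algebras.\<close>
  ultimately have "(\<lambda>\<xi>. \<xi>) \<in> measurable ?M (state_space T)"
    unfolding state_space_def by (intro measurable_pair) (simp_all add: comp_def)
  from measurable_sets[OF this] show "sets (state_space T) \<subseteq> sigma_sets ?S ?G"
    using G sets.sets_into_space[of _ "state_space T"] by (force simp: sp sets_measure_of Int_absorb2)
  have "?G \<subseteq> sets (state_space T)"
  proof
    fix B assume B: "B \<in> ?G"
    then have "(indicator B :: _ \<Rightarrow> real) \<in> borel_measurable (state_space T)"
      using continuous_measurable_state[OF T] by auto
    then have "(indicator B :: _ \<Rightarrow> real) -` {1} \<inter> space (state_space T) \<in> sets (state_space T)"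
      by (rule measurable_sets) simp
    also have "(indicator B :: _ \<Rightarrow> real) -` {1} \<inter> space (state_space T) = B"
      using B by (auto simp: indicator_def)
    finally show "B \<in> sets (state_space T)" .
  qed
  then show "sigma_sets ?S ?G \<subseteq> sets (state_space T)"
    using sets.sigma_sets_subset[of ?G "state_space T"] by simp
qed

section \<open>Finiteness of kappa and integration against it\<close>

context
  fixes \<phi> lam \<mu> :: real and T :: "'d::finite site set" and \<sigma> :: "'d site \<Rightarrow> real"
  assumes T: "finite T" and \<sigma>: "\<And>z. z \<in> T \<Longrightarrow> \<sigma> z > 0"
begin

lemma kappa_density:
  shows "(\<lambda>(z, x). 1 / \<sigma> z * exp (\<phi> * occ x z)) \<in> borel_measurable (count_space T \<Otimes>\<^sub>M bernoulli_measure lam \<mu>)"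
    and "integrable (count_space T \<Otimes>\<^sub>M bernoulli_measure lam \<mu>) (\<lambda>(z, x). 1 / \<sigma> z * exp (\<phi> * occ x z))"
proof -
  let ?B = "bernoulli_measure lam \<mu> :: 'd config measure"
  interpret B: prob_space ?B by (rule prob_space_bernoulli_measure)
  show m: "(\<lambda>(z, x). 1 / \<sigma> z * exp (\<phi> * occ x z)) \<in> borel_measurable (count_space T \<Otimes>\<^sub>M ?B)"
  proof (rule measurable_pair_measure_countable1)
    show "countable T" using T by (rule countable_finite)
    fix z note measurable_occ[of z lam \<mu>, measurable]
    show "(\<lambda>x. case (z, x) of (z, x) \<Rightarrow> 1 / \<sigma> z * exp (\<phi> * occ x z)) \<in> borel_measurable ?B"
      unfolding prod.case by measurable
  qed
  interpret N: finite_measure "count_space T \<Otimes>\<^sub>M ?B"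
    by (intro finite_measure_pair_measure finite_measure_count_space T) unfold_locales
  \<comment> \<open>The sum of all 1/\<sigma> serves as a common bound for the individual
    terms.\<close>
  have "\<bar>1 / \<sigma> z * exp (\<phi> * occ x z)\<bar> \<le> (\<Sum>z\<in>T. 1 / \<sigma> z) * exp \<bar>\<phi>\<bar>" if z: "z \<in> T" for z x
  proof -
    have "1 / \<sigma> z \<le> (\<Sum>z\<in>T. 1 / \<sigma> z)"
      using member_le_sum[OF z, of "\<lambda>z. 1 / \<sigma> z"] \<sigma> T by (simp add: less_imp_le)
    moreover have "exp (\<phi> * occ x z) \<le> exp \<bar>\<phi>\<bar>" by (auto simp: occ_def)
    ultimately have "1 / \<sigma> z * exp (\<phi> * occ x z) \<le> (\<Sum>z\<in>T. 1 / \<sigma> z) * exp \<bar>\<phi>\<bar>"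
      by (intro mult_mono sum_nonneg) (use \<sigma> in \<open>auto simp: less_imp_le\<close>)
    then show ?thesis using \<sigma>[OF z] by (simp add: abs_mult)
  qed
  then show "integrable (count_space T \<Otimes>\<^sub>M ?B) (\<lambda>(z, x). 1 / \<sigma> z * exp (\<phi> * occ x z))"
    by (intro N.integrable_const_bound[where B = "(\<Sum>z\<in>T. 1 / \<sigma> z) * exp \<bar>\<phi>\<bar>", OF AE_I2 m])
      (auto simp: space_pair_measure)
qed

lemma finite_measure_kappa: "finite_measure (kappa \<phi> lam \<mu> T \<sigma>)"
proof (rule finite_measureI)
  let ?N = "count_space T \<Otimes>\<^sub>M (bernoulli_measure lam \<mu> :: 'd config measure)"
  let ?D = "\<lambda>(z, x). 1 / \<sigma> z * exp (\<phi> * occ x z)"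
  have "emeasure (kappa \<phi> lam \<mu> T \<sigma>) (space (kappa \<phi> lam \<mu> T \<sigma>)) = (\<integral>\<^sup>+p. ennreal (?D p) \<partial>?N)"
    unfolding kappa_def using kappa_density(1)
    by (subst emeasure_density) (auto simp: case_prod_unfold intro!: nn_integral_cong)
  also have "\<dots> = ennreal (\<integral>p. ?D p \<partial>?N)"
    by (rule nn_integral_eq_integral[OF kappa_density(2)])
      (auto simp: space_pair_measure \<sigma> less_imp_le intro!: AE_I2)
  finally show "emeasure (kappa \<phi> lam \<mu> T \<sigma>) (space (kappa \<phi> lam \<mu> T \<sigma>)) \<noteq> \<infinity>" by simp
qed

lemma integrable_kappa:
  assumes f: "continuous_on (T \<times> UNIV) f"
  shows "integrable (kappa \<phi> lam \<mu> T \<sigma>) (f :: _ \<Rightarrow> real)"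
proof -
  obtain c where c: "\<And>\<xi>. \<xi> \<in> T \<times> UNIV \<Longrightarrow> \<bar>f \<xi>\<bar> \<le> c" using continuous_bounded_state[OF T f] by blast
  have "f \<in> borel_measurable (kappa \<phi> lam \<mu> T \<sigma>)"
    using continuous_measurable_state[OF T f] by (simp add: measurable_cong_sets[OF sets_kappa refl])
  moreover have "space (kappa \<phi> lam \<mu> T \<sigma>) = T \<times> UNIV"
    using sets_eq_imp_space_eq[OF sets_kappa] by simp
  ultimately show ?thesis
    using c by (intro finite_measure.integrable_const_bound[OF finite_measure_kappa, of _ c]) auto
qed

lemma integral_kappa:
  assumes f: "continuous_on (T \<times> UNIV) f"
  shows "(\<integral>\<xi>. f \<xi> \<partial>kappa \<phi> lam \<mu> T \<sigma>)
    = (\<Sum>z\<in>T. 1 / \<sigma> z * (\<integral>x. exp (\<phi> * occ x z) * f (z, x) \<partial>bernoulli_measure lam \<mu>))"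
proof -
  let ?B = "bernoulli_measure lam \<mu> :: 'd config measure"
  let ?N = "count_space T \<Otimes>\<^sub>M ?B"
  let ?D = "\<lambda>(z, x). 1 / \<sigma> z * exp (\<phi> * occ x z)"
  interpret B: prob_space ?B by (rule prob_space_bernoulli_measure)
  interpret C: finite_measure "count_space T" by (rule finite_measure_count_space[OF T])
  interpret N: pair_sigma_finite "count_space T" ?B ..
  have kappa: "kappa \<phi> lam \<mu> T \<sigma> = density ?N (\<lambda>p. ennreal (?D p))"
    unfolding kappa_def by (intro arg_cong2[of _ _ _ _ density]) auto
  have sets_N: "sets ?N = sets (state_space T)"
    unfolding state_space_def by (intro sets_pair_measure_cong refl sets_bernoulli_measure)
  have fm: "f \<in> borel_measurable ?N"
    using continuous_measurable_state[OF T f] by (simp add: measurable_cong_sets[OF sets_N refl])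
  have D0: "AE p in ?N. 0 \<le> ?D p"
    by (rule AE_I2) (auto simp: space_pair_measure \<sigma> less_imp_le)
  have int: "integrable ?N (\<lambda>p. ?D p * f p)"
    using integrable_kappa[OF f] integrable_real_density[OF kappa_density(1) D0 fm]
    unfolding kappa by blast
  have "(\<integral>\<xi>. f \<xi> \<partial>kappa \<phi> lam \<mu> T \<sigma>) = (\<integral>p. ?D p * f p \<partial>?N)"
    unfolding kappa using integral_real_density[OF kappa_density(1) D0 fm] by simp
  also have "\<dots> = (\<integral>z. \<integral>x. ?D (z, x) * f (z, x) \<partial>?B \<partial>count_space T)"
    by (rule N.integral_fst'[OF int, symmetric])
  also have "\<dots> = (\<Sum>z\<in>T. \<integral>x. 1 / \<sigma> z * (exp (\<phi> * occ x z) * f (z, x)) \<partial>?B)"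
    by (simp add: lebesgue_integral_count_space_finite[OF T])
  finally show ?thesis by (simp only: integral_mult_right_zero)
qed

text \<open>Sup-norm continuity of the functional, used both to pass to the closure of the operator
  and to pass from the domain to all continuous functions.\<close>

lemma integral_kappa_bound:
  assumes f: "continuous_on (T \<times> UNIV) f" and c: "\<And>\<xi>. \<xi> \<in> T \<times> UNIV \<Longrightarrow> \<bar>f \<xi>\<bar> \<le> c"
  shows "\<bar>\<integral>\<xi>. f \<xi> \<partial>kappa \<phi> lam \<mu> T \<sigma>\<bar> \<le> measure (kappa \<phi> lam \<mu> T \<sigma>) (T \<times> UNIV) * c"
proof -
  let ?\<kappa> = "kappa \<phi> lam \<mu> T \<sigma>"
  interpret finite_measure ?\<kappa> by (rule finite_measure_kappa)
  have space: "space ?\<kappa> = T \<times> UNIV" using sets_eq_imp_space_eq[OF sets_kappa] by simp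
  have "\<bar>\<integral>\<xi>. f \<xi> \<partial>?\<kappa>\<bar> \<le> (\<integral>\<xi>. \<bar>f \<xi>\<bar> \<partial>?\<kappa>)" by (rule integral_abs_bound)
  also have "\<dots> \<le> (\<integral>\<xi>. c \<partial>?\<kappa>)"
    using c by (intro integral_mono integrable_abs integrable_kappa f) (auto simp: space)
  finally show ?thesis by (simp add: space)
qed

end

section \<open>Stationarity of the closed operator\<close>

lemma sum_symmetric_differences:
  fixes I :: "'a \<Rightarrow> real"
  assumes "\<And>z z'. z \<in> T \<Longrightarrow> z' \<in> T \<Longrightarrow> \<tau> z z' = \<tau> z' z"
  shows "(\<Sum>z\<in>T. \<Sum>z'\<in>T. \<tau> z z' * (I z' - I z)) = 0"
proof -
  have "(\<Sum>z\<in>T. \<Sum>z'\<in>T. \<tau> z z' * I z') = (\<Sum>z\<in>T. \<Sum>z'\<in>T. \<tau> z z' * I z)"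
    by (subst sum.swap) (simp add: assms cong: sum.cong)
  then show ?thesis by (simp add: right_diff_distrib sum_subtractf)
qed

text \<open>On the core, the integral over each section reduces to the \<tau>-weighted differences
  of the Bernoulli means of f, which cancel by symmetry when summed over T. An element of the
  closure has an image that is a uniform limit of core images.\<close>

lemma closed_R_stationary:
  fixes \<phi> lam \<mu> :: real
    and \<beta> \<tau> w :: "'d::finite site \<Rightarrow> 'd site \<Rightarrow> real"
    and \<alpha> \<sigma> :: "'d site \<Rightarrow> real"
  assumes lam: "lam > 0" and \<mu>: "\<mu> > 0"
    and \<beta>_sym: "\<And>i i'. \<beta> i i' = \<beta> i' i" and \<beta>_nonneg: "\<And>i i'. \<beta> i i' \<ge> 0"
    and \<beta>_sup: "(SUP i. \<Sum>\<^sub>\<infinity>i'. ennreal (\<beta> i i')) < \<infinity>"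
    and T: "finite T"
    and \<tau>: "\<And>z z'. z \<in> T \<Longrightarrow> z' \<in> T \<Longrightarrow> \<tau> z z' = \<tau> z' z"
    and \<sigma>: "\<And>z. z \<in> T \<Longrightarrow> \<sigma> z > 0"
    and w: "w = (\<lambda>_ _. 1) \<or> w = \<beta>"
    and fh: "(f, h) \<in> closed_R w \<phi> lam \<mu> \<beta> T \<tau> \<alpha> \<sigma>"
  shows "(\<integral>\<xi>. h \<xi> \<partial>kappa \<phi> lam \<mu> T \<sigma>) = 0"
proof -
  let ?B = "bernoulli_measure lam \<mu> :: 'd config measure"
  let ?\<kappa> = "kappa \<phi> lam \<mu> T \<sigma>" and ?S = "T \<times> (UNIV :: 'd config set)"
  let ?R = "op_R \<phi> lam \<mu> \<beta> T \<tau> \<alpha> \<sigma>"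
  interpret B: prob_space ?B by (rule prob_space_bernoulli_measure)
  have core: "(\<integral>\<xi>. h \<xi> \<partial>?\<kappa>) = 0"
    if f: "f \<in> C_L_T w T" and h: "continuous_on ?S h" and hR: "\<And>\<xi>. \<xi> \<in> ?S \<Longrightarrow> h \<xi> = ?R f \<xi>" for f h
  proof -
    define I where "I z = (\<integral>x. f (z, x) \<partial>?B)" for z
    have "1 / \<sigma> z * (\<integral>x. exp (\<phi> * occ x z) * h (z, x) \<partial>?B) = (\<Sum>z'\<in>T. \<tau> z z' * (I z' - I z))"
      if z: "z \<in> T" for z
    proof -
      let ?L = "\<lambda>x. op_L \<phi> lam \<mu> \<beta> z (\<lambda>y. f (z, y)) x"
      have gz: "(\<lambda>y. f (z, y)) \<in> C_L w" using f z by (simp add: C_L_T_def)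
      note stat = op_L_stationary[OF lam \<mu> \<beta>_sym \<beta>_nonneg \<beta>_sup w gz, of \<phi> z]
      have f_int: "integrable ?B (\<lambda>x. f (y, x))" if y: "y \<in> T" for y
      proof -
        have y_cont: "continuous_on UNIV (\<lambda>x. f (y, x))" using f y by (simp add: C_L_T_def C_L_def)
        obtain c where "\<And>x. \<bar>f (y, x)\<bar> \<le> c" using continuous_config_bounded[OF y_cont] by blast
        then show ?thesis
          by (intro B.integrable_const_bound[OF _ continuous_measurable_config[OF y_cont], of c]) auto
      qed
      have A_int: "integrable ?B (\<lambda>x. op_A T \<tau> f (z, x))"
        unfolding op_A_def prod.case
        by (intro Bochner_Integration.integrable_sum integrable_mult_right Bochner_Integration.integrable_diff f_int z)
      \<comment> \<open>The density cancels the denominator of the motion term, leaving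
        \<open>\<sigma> z\<close>, which the outer factor 1/\<sigma>(z) then removes.\<close>
      have "exp (\<phi> * occ x z) * h (z, x) = \<alpha> z * (exp (\<phi> * occ x z) * ?L x) + \<sigma> z * op_A T \<tau> f (z, x)" for x
        using hR[of "(z, x)"] z by (simp add: op_R_def field_simps)
      then have "(\<integral>x. exp (\<phi> * occ x z) * h (z, x) \<partial>?B)
          = \<alpha> z * (\<integral>x. exp (\<phi> * occ x z) * ?L x \<partial>?B) + \<sigma> z * (\<integral>x. op_A T \<tau> f (z, x) \<partial>?B)"
        using stat(1) A_int by simp
      also have "(\<integral>x. op_A T \<tau> f (z, x) \<partial>?B) = (\<Sum>z'\<in>T. \<tau> z z' * (I z' - I z))"
        unfolding op_A_def prod.case I_def using f_int z by simp
      finally show ?thesis using stat(2) \<sigma>[OF z] by simp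
    qed
    then show ?thesis
      by (simp add: integral_kappa[where T = T and \<sigma> = \<sigma>, OF T \<sigma> h] sum_symmetric_differences[OF \<tau>])
  qed
  obtain F H where h: "continuous_on ?S h"
    and core_FH: "\<And>n. (F n, H n) \<in> {(f, h). f \<in> C_L_T w T \<and> continuous_on ?S h \<and> (\<forall>\<xi>\<in>?S. h \<xi> = ?R f \<xi>)}"
    and lim: "uniform_limit ?S H h sequentially"
    using fh unfolding closed_R_def graph_closure_def by blast
  have FH: "F n \<in> C_L_T w T" "continuous_on ?S (H n)" "\<And>\<xi>. \<xi> \<in> ?S \<Longrightarrow> H n \<xi> = ?R (F n) \<xi>" for n
    using core_FH[of n] by auto
  define C where "C = measure ?\<kappa> ?S"
  have C: "C \<ge> 0" by (simp add: C_def)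
  have "\<bar>\<integral>\<xi>. h \<xi> \<partial>?\<kappa>\<bar> \<le> e" if e: "e > 0" for e
  proof -
    have "\<forall>\<^sub>F n in sequentially. \<forall>\<xi>\<in>?S. dist (H n \<xi>) (h \<xi>) < e / (C + 1)"
      using e C by (intro uniform_limitD[OF lim]) (simp add: add_nonneg_pos)
    from eventually_happens'[OF sequentially_bot this]
    obtain n where n: "\<forall>\<xi>\<in>?S. dist (H n \<xi>) (h \<xi>) < e / (C + 1)" ..
    \<comment> \<open>\<open>H n\<close> has integral zero, so this difference has the same integral
      as h, while uniform closeness makes it small.\<close>
    have "\<bar>\<integral>\<xi>. h \<xi> - H n \<xi> \<partial>?\<kappa>\<bar> \<le> C * (e / (C + 1))"
      unfolding C_def using n
      by (intro integral_kappa_bound T \<sigma> continuous_intros h FH) (auto simp: C_def dist_real_def abs_minus_commute less_imp_le)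
    also have "(\<integral>\<xi>. h \<xi> - H n \<xi> \<partial>?\<kappa>) = (\<integral>\<xi>. h \<xi> \<partial>?\<kappa>)"
      by (subst Bochner_Integration.integral_diff) (use core[OF FH] \<sigma> in \<open>auto intro!: integrable_kappa T h FH\<close>)
    also have "C * (e / (C + 1)) \<le> e" using C e by (simp add: field_simps)
    finally show ?thesis .
  qed
  then have "\<bar>\<integral>\<xi>. h \<xi> \<partial>?\<kappa>\<bar> \<le> 0" by (rule field_le_epsilon) auto
  then show ?thesis by simp
qed

theorem theorem3p1:
  fixes \<phi> lam \<mu> :: real
    and \<beta> \<tau> w :: "'d::finite site \<Rightarrow> 'd site \<Rightarrow> real"
    and T :: "'d site set"
    and \<alpha> \<sigma> :: "'d site \<Rightarrow> real"
    and P :: "real \<Rightarrow> ('d site \<times> 'd config \<Rightarrow> real) \<Rightarrow> 'd site \<times> 'd config \<Rightarrow> real"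
    and \<Omega> :: "'w measure"
    and Pr :: "'d site \<times> 'd config \<Rightarrow> 'w measure"
    and ZX :: "real \<Rightarrow> 'w \<Rightarrow> 'd site \<times> 'd config"
  assumes "lam > 0" and "\<mu> > 0"
    and "\<And>i i'. \<beta> i i' = \<beta> i' i" and "\<And>i i'. \<beta> i i' \<ge> 0" and "\<And>i. \<beta> i i = 0"
    and "(SUP i. \<Sum>\<^sub>\<infinity>i'. ennreal (\<beta> i i')) < \<infinity>"
    and "finite T"
    and "\<And>z z'. z \<in> T \<Longrightarrow> z' \<in> T \<Longrightarrow> \<tau> z z' = \<tau> z' z"
    and "\<And>z z'. z \<in> T \<Longrightarrow> z' \<in> T \<Longrightarrow> \<tau> z z' \<ge> 0"
    and "\<And>z. z \<in> T \<Longrightarrow> \<tau> z z = 0"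
    and "\<And>z. z \<in> T \<Longrightarrow> \<alpha> z > 0" and "\<And>z. z \<in> T \<Longrightarrow> \<sigma> z > 0"
    and "w = (\<lambda>_ _. 1) \<or> w = \<beta>"
    and "feller_semigroup (T \<times> UNIV) P"
    and "generator (T \<times> UNIV) P = closed_R w \<phi> lam \<mu> \<beta> T \<tau> \<alpha> \<sigma>"
    and "feller_process P (state_space T) \<Omega> Pr ZX"
  shows "finite_measure (kappa \<phi> lam \<mu> T \<sigma>) \<and>
         invariant_measure \<Omega> Pr ZX (kappa \<phi> lam \<mu> T \<sigma>)"
proof
  note T = \<open>finite T\<close> and \<sigma> = assms(12) and feller = \<open>feller_semigroup (T \<times> UNIV) P\<close>
  let ?\<kappa> = "kappa \<phi> lam \<mu> T \<sigma>"
  show fin: "finite_measure ?\<kappa>" by (rule finite_measure_kappa[OF T \<sigma>])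
  show "invariant_measure \<Omega> Pr ZX ?\<kappa>"
  proof (rule invariant_measureI[OF assms(16) fin sets_kappa], unfold space_state_space)
    fix t :: real and f :: "'d site \<times> 'd config \<Rightarrow> real"
    assume t: "0 \<le> t" and f: "continuous_on (T \<times> UNIV) f"
    show "continuous_on (T \<times> UNIV) (P t f)" by (rule feller_cont[OF feller t f])
    show "(\<integral>\<xi>. P t f \<xi> \<partial>?\<kappa>) = (\<integral>\<xi>. f \<xi> \<partial>?\<kappa>)"
    proof (rule functional_invariant[OF feller, where \<Lambda> = "\<lambda>f. \<integral>\<xi>. f \<xi> \<partial>?\<kappa>"
          and C = "measure ?\<kappa> (T \<times> UNIV)", OF _ _ _ f t])
      fix f g :: "'d site \<times> 'd config \<Rightarrow> real" and a b
      assume "continuous_on (T \<times> UNIV) f" "continuous_on (T \<times> UNIV) g"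
      then show "(\<integral>\<eta>. a * f \<eta> + b * g \<eta> \<partial>?\<kappa>) = a * (\<integral>\<eta>. f \<eta> \<partial>?\<kappa>) + b * (\<integral>\<eta>. g \<eta> \<partial>?\<kappa>)"
        by (simp add: integrable_kappa[OF T \<sigma>])
    next
      fix f :: "'d site \<times> 'd config \<Rightarrow> real" and c
      assume "continuous_on (T \<times> UNIV) f" "\<And>\<eta>. \<eta> \<in> T \<times> UNIV \<Longrightarrow> \<bar>f \<eta>\<bar> \<le> c"
      then show "\<bar>\<integral>\<eta>. f \<eta> \<partial>?\<kappa>\<bar> \<le> measure ?\<kappa> (T \<times> UNIV) * c"
        using \<sigma> by (intro integral_kappa_bound T) auto
    next
      fix f h assume "(f, h) \<in> generator (T \<times> UNIV) P"
      then have fh: "(f, h) \<in> closed_R w \<phi> lam \<mu> \<beta> T \<tau> \<alpha> \<sigma>" by (simp only: assms(15))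
      show "(\<integral>\<eta>. h \<eta> \<partial>?\<kappa>) = 0"
        by (rule closed_R_stationary[OF assms(1-4,6,7) _ _ assms(13) fh]) (use assms(8) \<sigma> in auto)
    qed
  qed (use continuous_measurable_state[OF T] sets_state_space_clopen[OF T] in auto)
qed

end
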